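(* For all $s\ge1$ and $m\in\mathbb N$ there exist two constants $b_{m,s}\in(0,1)$ and $L_{m,s}>0$ such that if $0\le\alpha<2$, $\epsilon\in(0,1)$, and $u$ is the solution of $$i\partial_tu+\epsilon^\alpha\partial_x^2u=\Pi(|u|^2u)$$ with $u(0)\in H^s_+$ and $\|u(0)-\mathbf e_m\|_{H^s}=\epsilon$, then $$\sup_{|t|\le b_{m,s}\,\epsilon^{-(1-\frac\alpha2)}}\ \inf_{\theta\in\mathbb R}\|u(t)-e^{i\theta}\mathbf e_m\|_{H^s}\le L_{m,s}\,\epsilon^{1-\frac\alpha2}.$$
   Context: $\mathbb N=\{0,1,2,\dots\}$, $\mathbb S^1=\mathbb R/2\pi\mathbb Z$, $\mathbf e_m(x)=e^{imx}$. $\Pi$ is the Szegő projector $\Pi(\sum_{k\in\mathbb Z}u_ke^{ikx})=\sum_{k\ge0}u_ke^{ikx}$ on $L^2(\mathbb S^1)$; $L^2_+=\Pi(L^2(\mathbb S^1))$, $H^s_+=H^s(\mathbb S^1)\cap L^2_+$, with $\|u\|_{H^s}^2=\sum_k(1+k^2)^s|u_k|^2$. For data in $H^s_+$, $s\ge\frac12$, the solution is the unique global solution $u\in C(\mathbb R,H^s_+)$. *)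

theory Defs
  imports "HOL-Analysis.Analysis"
begin

text \<open>
  A function on the circle is a \<open>2\<pi>\<close>-periodic function on the real line; elements of \<open>L\<^sup>2\<close> are given
  by representatives, and every norm below only depends on the class modulo null sets.
\<close>

definition e_mode :: "int \<Rightarrow> real \<Rightarrow> complex" where
  "e_mode k x = exp (\<i> * of_int k * of_real x)"

definition L2_circle :: "(real \<Rightarrow> complex) set" where
  "L2_circle = {f. (\<forall>x. f (x + 2 * pi) = f x) \<and> f \<in> borel_measurable lebesgue \<and>
                   set_integrable lebesgue {0..2 * pi} (\<lambda>x. (cmod (f x))\<^sup>2)}"

definition fourier :: "(real \<Rightarrow> complex) \<Rightarrow> int \<Rightarrow> complex" where
  "fourier f k = (1 / (2 * pi)) * (LINT x:{0..2 * pi}|lebesgue. f x * e_mode (- k) x)"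

text \<open>
  A formal Fourier series, given by its coefficients, stands for a periodic distribution.
  The distributional derivative multiplies the \<open>k\<close>-th coefficient by \<open>i k\<close>.
  The spaces \<open>H\<^sup>r\<close> are needed for negative \<open>r\<close> too, because \<open>\<partial>\<^sub>t u\<close> and \<open>\<partial>\<^sub>x\<^sup>2 u\<close> take values
  in \<open>H\<^sup>s\<^sup>-\<^sup>2\<close> when \<open>u\<close> takes values in \<open>H\<^sup>s\<close>.
\<close>

type_synonym fseries = "int \<Rightarrow> complex"

definition Dx :: "fseries \<Rightarrow> fseries" where
  "Dx a k = \<i> * of_int k * a k"

definition szego :: "fseries \<Rightarrow> fseries" where
  "szego a k = (if k \<ge> 0 then a k else 0)"

definition Hspace :: "real \<Rightarrow> fseries set" where
  "Hspace r = {a. (\<lambda>k. (1 + (real_of_int k)\<^sup>2) powr r * (cmod (a k))\<^sup>2) summable_on UNIV}"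

text \<open>Only meaningful on \<^term>\<open>Hspace r\<close>: a divergent sum has the value 0.\<close>

definition Hnorm :: "real \<Rightarrow> fseries \<Rightarrow> real" where
  "Hnorm r a = sqrt (\<Sum>\<^sub>\<infinity>k. (1 + (real_of_int k)\<^sup>2) powr r * (cmod (a k))\<^sup>2)"

definition L2_plus :: "(real \<Rightarrow> complex) set" where
  "L2_plus = {f \<in> L2_circle. \<exists>g \<in> L2_circle. fourier f = szego (fourier g)}"

definition sobolev_plus :: "real \<Rightarrow> (real \<Rightarrow> complex) set" where
  "sobolev_plus s = {f \<in> L2_plus. fourier f \<in> Hspace s}"

definition sobolev_norm :: "real \<Rightarrow> (real \<Rightarrow> complex) \<Rightarrow> real" where
  "sobolev_norm s f = Hnorm s (fourier f)"

definition continuous_sobolev_plus :: "real \<Rightarrow> (real \<Rightarrow> real \<Rightarrow> complex) \<Rightarrow> bool" where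
  "continuous_sobolev_plus s u \<longleftrightarrow>
     (\<forall>t. u t \<in> sobolev_plus s) \<and>
     (\<forall>t. ((\<lambda>\<tau>. sobolev_norm s (\<lambda>x. u \<tau> x - u t x)) \<longlongrightarrow> 0) (at t))"

definition has_Hspace_derivative :: "real \<Rightarrow> (real \<Rightarrow> fseries) \<Rightarrow> fseries \<Rightarrow> real \<Rightarrow> bool" where
  "has_Hspace_derivative r a v t \<longleftrightarrow>
     v \<in> Hspace r \<and> (\<forall>\<tau>. a \<tau> \<in> Hspace r) \<and>
     ((\<lambda>h. Hnorm r (\<lambda>k. (a (t + h) k - a t k) / of_real h - v k)) \<longlongrightarrow> 0) (at 0)"

text \<open>
  Solutions of \<open>i \<partial>\<^sub>t u + \<nu> \<partial>\<^sub>x\<^sup>2 u = \<Pi>(|u|\<^sup>2 u)\<close> in \<open>C(\<real>, H\<^sup>s\<^sub>+)\<close>. The derivative in time is taken in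
  \<open>H\<^sup>s\<^sup>-\<^sup>2\<close> and the equation is an identity between elements of \<open>H\<^sup>s\<^sup>-\<^sup>2\<close>.
\<close>

definition szego_schroedinger_solution ::
  "real \<Rightarrow> real \<Rightarrow> (real \<Rightarrow> real \<Rightarrow> complex) \<Rightarrow> bool" where
  "szego_schroedinger_solution s \<nu> u \<longleftrightarrow>
     continuous_sobolev_plus s u \<and>
     (\<forall>t. \<exists>v. has_Hspace_derivative (s - 2) (\<lambda>\<tau>. fourier (u \<tau>)) v t \<and>
        (\<forall>k. \<i> * v k + of_real \<nu> * Dx (Dx (fourier (u t))) k
               = szego (fourier (\<lambda>x. of_real ((cmod (u t x))\<^sup>2) * u t x)) k))"

end

theory Submission
  imports Defs
begin

text \<open>
  Write \<open>a k\<close> for the Fourier coefficients of \<open>u(t)\<close>, \<open>\<nu> = \<epsilon>\<^sup>\<alpha>\<close> for the dispersion and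
  \<open>\<delta> = \<epsilon>\<close> to the power \<open>1 - \<alpha>/2\<close>, so that \<open>\<epsilon>\<^sup>2 = \<nu> \<delta>\<^sup>2\<close>. Two mechanisms give the result: the
  conservation laws control the low modes for all times, and an energy estimate controls the modes
  above \<open>2m\<close> on a time interval of length of order \<open>1/\<delta>\<close>.

  Conservation laws. Mass \<open>\<Sum>|a k|\<^sup>2\<close>, momentum \<open>\<Sum>k|a k|\<^sup>2\<close> and energy \<open>\<nu> \<Sum>k\<^sup>2|a k|\<^sup>2 + G/2\<close> are
  conserved, where \<open>G\<close> is the mean of \<open>|u|\<^sup>4\<close>. Together they make \<open>\<nu> D + G/2\<close> constant, where
  \<open>D = \<Sum>(k - m)\<^sup>2|a k|\<^sup>2\<close> is the spread around the mode \<open>m\<close>. The difference \<open>G - M\<^sup>2\<close>, where \<open>M\<close> is the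
  mass, is the variance of \<open>|u|\<^sup>2\<close>: it is never negative, and at time \<open>0\<close> it is \<open>O(\<epsilon>\<^sup>2)\<close>, since
  \<open>|u|\<close> is then within \<open>O(\<epsilon>)\<close> of \<open>1\<close>. Hence \<open>\<nu> D(t) \<le> \<nu> D(0) + O(\<epsilon>\<^sup>2)\<close>, which is
  \<open>D(t) = O(\<delta>\<^sup>2)\<close> for every \<open>t\<close> (\<open>spread_le\<close>). The factor \<open>\<nu>\<close> lost here is what turns \<open>\<epsilon>\<close> into
  \<open>\<delta>\<close>. It also follows that \<open>|a m| = 1 + O(\<delta>)\<close> (\<open>amplitude\<close>).

  High modes. Write \<open>u\<close> as \<open>a m\<close> times the mode \<open>m\<close> plus a remainder \<open>w\<close>. In the equation of a mode
  \<open>k > 2m\<close> the terms linear in \<open>w\<close> are \<open>2|a m|\<^sup>2 w k\<close>, which only rotates the phase, and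
  \<open>(a m)\<^sup>2\<close> times the conjugate of \<open>w (2m - k)\<close>, which vanishes because the frequency is negative
  (\<open>high_mode_tri\<close>). So the \<open>H\<^sup>s\<close> energy of these modes grows at the rate \<open>O(|w|\<^sup>3)\<close>, and, as
  long as \<open>|w| = O(\<delta>)\<close>, it changes by \<open>O(b \<delta>\<^sup>2)\<close> during the time \<open>b/\<delta>\<close>. For small \<open>b\<close> a
  continuity argument closes (\<open>W_improve\<close>, \<open>continuous_bootstrap\<close>), and the phase of \<open>a m\<close> is the
  \<open>\<theta>\<close> of the theorem.

  The solution is only as regular as \<open>H\<^sup>s\<close>, so the conservation laws are derived on finitely many
  modes. Truncation keeps the algebraic structure: the only error is the difference between the
  nonlinearity and its truncation, which tends to \<open>0\<close> boundedly in \<open>H\<^sup>s\<close>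
  (\<open>truncated_conservation_laws\<close>, \<open>truncated_law_conserved\<close>). The analytic input is the trilinear
  estimate \<open>pnorm_tri_le\<close>. The passage from functions to coefficients, \<open>fourier_cubic_sobolev\<close>,
  rests on the fact that an integrable function with vanishing Fourier coefficients vanishes almost
  everywhere.
\<close>

section \<open>Weighted norms of coefficient sequences\<close>

text \<open>
  The square of the bracket is the weight of \<^const>\<open>Hspace\<close>.
\<close>

definition bracket :: "real \<Rightarrow> int \<Rightarrow> real" where
  "bracket s k = (1 + (real_of_int k)\<^sup>2) powr (s / 2)"

text \<open>
  Estimates are proved for finite partial norms, with constants independent of the finite set, and
  passed to the limit afterwards; no summability has to be discussed before that.
\<close>

definition pnorm :: "real \<Rightarrow> int set \<Rightarrow> fseries \<Rightarrow> real" where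
  "pnorm s F a = L2_set (\<lambda>k. bracket s k * cmod (a k)) F"

lemma bracket_pos [simp]: "bracket s k > 0"
proof -
  have "1 + (real_of_int k)\<^sup>2 > 0" by (smt (verit) zero_le_power2)
  then show ?thesis by (simp add: bracket_def)
qed

lemma bracket_nonneg [simp]: "bracket s k \<ge> 0"
  using bracket_pos[of s k] by linarith

lemma bracket_nonzero [simp]: "bracket s k \<noteq> 0"
  using bracket_pos[of s k] by linarith

lemma bracket_square: "(bracket s k)\<^sup>2 = (1 + (real_of_int k)\<^sup>2) powr s"
proof -
  have "bracket s k ^ 2 = bracket s k * bracket s k" by (simp add: power2_eq_square)
  also have "\<dots> = (1 + (real_of_int k)\<^sup>2) powr (s / 2 + s / 2)"
    unfolding bracket_def by (simp only: powr_add)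
  finally show ?thesis by simp
qed

lemma one_plus_square_le_bracket:
  assumes "s \<ge> 1" shows "1 + (real_of_int k)\<^sup>2 \<le> (bracket s k)\<^sup>2"
proof -
  have "(1 + (real_of_int k)\<^sup>2) powr 1 \<le> (1 + (real_of_int k)\<^sup>2) powr s"
    using assms by (intro powr_mono) auto
  then show ?thesis by (simp add: bracket_square add_nonneg_nonneg)
qed

lemma pnorm_nonneg [simp]: "pnorm s F a \<ge> 0"
  by (simp add: pnorm_def L2_set_nonneg)

lemma pnorm_square: "(pnorm s F a)\<^sup>2 = (\<Sum>k\<in>F. (bracket s k)\<^sup>2 * (cmod (a k))\<^sup>2)"
  by (simp add: pnorm_def L2_set_def sum_nonneg power_mult_distrib)

lemma pnorm_mono:
  assumes "\<And>k. k \<in> F \<Longrightarrow> cmod (a k) \<le> cmod (b k)"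
  shows "pnorm s F a \<le> pnorm s F b"
  unfolding pnorm_def by (intro L2_set_mono mult_left_mono assms) auto

lemma pnorm_triangle: "pnorm s F (\<lambda>k. a k + b k) \<le> pnorm s F a + pnorm s F b"
proof -
  have "pnorm s F (\<lambda>k. a k + b k)
      \<le> L2_set (\<lambda>k. bracket s k * cmod (a k) + bracket s k * cmod (b k)) F"
    unfolding pnorm_def
    by (intro L2_set_mono) (auto simp flip: distrib_left intro!: mult_left_mono norm_triangle_ineq)
  also have "\<dots> \<le> pnorm s F a + pnorm s F b"
    unfolding pnorm_def by (rule L2_set_triangle_ineq)
  finally show ?thesis .
qed

lemma pnorm_scale: "pnorm s F (\<lambda>k. c * a k) = cmod c * pnorm s F a"
proof -
  have "pnorm s F (\<lambda>k. c * a k) = L2_set (\<lambda>k. cmod c * (bracket s k * cmod (a k))) F"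
    unfolding pnorm_def by (simp add: norm_mult mult.left_commute)
  then show ?thesis by (simp add: pnorm_def L2_set_right_distrib)
qed

lemma coefficient_le_pnorm:
  assumes "finite F" "k \<in> F" shows "bracket s k * cmod (a k) \<le> pnorm s F a"
  unfolding pnorm_def using member_le_L2_set[OF assms, of "\<lambda>k. bracket s k * cmod (a k)"] by simp

text \<open>
  Time derivatives of weighted sums of \<open>|a k|\<^sup>2\<close> have the form of the left-hand side.
\<close>

lemma abs_weighted_Im_pairing_le:
  assumes "\<And>k. k \<in> F \<Longrightarrow> \<bar>\<phi> k\<bar> \<le> c * (bracket s k)\<^sup>2" and c: "c \<ge> 0"
  shows "\<bar>\<Sum>k\<in>F. \<phi> k * Im (cnj (a k) * b k)\<bar> \<le> c * (pnorm s F a * pnorm s F b)"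
proof -
  have "\<bar>\<Sum>k\<in>F. \<phi> k * Im (cnj (a k) * b k)\<bar> \<le> (\<Sum>k\<in>F. \<bar>\<phi> k * Im (cnj (a k) * b k)\<bar>)"
    by (rule sum_abs)
  also have "\<dots> \<le> (\<Sum>k\<in>F. c * (\<bar>bracket s k * cmod (a k)\<bar> * \<bar>bracket s k * cmod (b k)\<bar>))"
  proof (rule sum_mono)
    fix k assume k: "k \<in> F"
    have "\<bar>\<phi> k * Im (cnj (a k) * b k)\<bar> \<le> (c * (bracket s k)\<^sup>2) * cmod (cnj (a k) * b k)"
      unfolding abs_mult by (intro mult_mono assms(1)[OF k] abs_Im_le_cmod) (use c in auto)
    then show "\<bar>\<phi> k * Im (cnj (a k) * b k)\<bar> \<le> c * (\<bar>bracket s k * cmod (a k)\<bar> * \<bar>bracket s k * cmod (b k)\<bar>)"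
      by (simp add: norm_mult power2_eq_square abs_mult mult_ac)
  qed
  also have "\<dots> \<le> c * (pnorm s F a * pnorm s F b)"
    unfolding sum_distrib_left[symmetric] pnorm_def
    by (intro mult_left_mono L2_set_mult_ineq c)
  finally show ?thesis .
qed

lemma Hnorm_nonneg [simp]: "Hnorm s a \<ge> 0"
  by (auto simp: Hnorm_def intro!: real_sqrt_ge_zero infsum_nonneg)

lemma pnorm_le_Hnorm:
  assumes "a \<in> Hspace s" "finite F" shows "pnorm s F a \<le> Hnorm s a"
proof -
  have "(\<Sum>k\<in>F. (1 + (real_of_int k)\<^sup>2) powr s * (cmod (a k))\<^sup>2)
      \<le> (\<Sum>\<^sub>\<infinity>k. (1 + (real_of_int k)\<^sup>2) powr s * (cmod (a k))\<^sup>2)"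
    using assms by (intro finite_sum_le_infsum) (auto simp: Hspace_def)
  then show ?thesis
    unfolding Hnorm_def pnorm_def L2_set_def
    by (simp add: power_mult_distrib bracket_square)
qed

lemma Hnorm_leI:
  assumes "\<And>F. finite F \<Longrightarrow> pnorm s F a \<le> B"
  shows "a \<in> Hspace s" and "Hnorm s a \<le> B"
proof -
  have B: "B \<ge> 0" using assms[of "{}"] by (simp add: pnorm_def)
  have *: "(\<Sum>k\<in>F. (1 + (real_of_int k)\<^sup>2) powr s * (cmod (a k))\<^sup>2) \<le> B\<^sup>2" if "finite F" for F
    using power_mono[OF assms[OF that], of 2] by (simp add: pnorm_square bracket_square)
  show mem: "a \<in> Hspace s"
    unfolding Hspace_def mem_Collect_eq
  proof (rule nonneg_bdd_above_summable_on)
    show "bdd_above (sum (\<lambda>k. (1 + (real_of_int k)\<^sup>2) powr s * (cmod (a k))\<^sup>2) ` {F. F \<subseteq> UNIV \<and> finite F})"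
      by (rule bdd_aboveI2[where M = "B\<^sup>2"]) (use * in blast)
  qed simp
  have "(\<Sum>\<^sub>\<infinity>k. (1 + (real_of_int k)\<^sup>2) powr s * (cmod (a k))\<^sup>2) \<le> B\<^sup>2"
    using mem * by (intro infsum_le_finite_sums) (auto simp: Hspace_def)
  then show "Hnorm s a \<le> B"
    unfolding Hnorm_def using B by (simp add: real_le_lsqrt)
qed

lemma Hspace_add:
  assumes "a \<in> Hspace s" "b \<in> Hspace s"
  shows "(\<lambda>k. a k + b k) \<in> Hspace s" "Hnorm s (\<lambda>k. a k + b k) \<le> Hnorm s a + Hnorm s b"
proof -
  have *: "pnorm s F (\<lambda>k. a k + b k) \<le> Hnorm s a + Hnorm s b" if "finite F" for F
    using pnorm_triangle[of s F a b] pnorm_le_Hnorm[OF assms(1) that] pnorm_le_Hnorm[OF assms(2) that]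
    by linarith
  show "(\<lambda>k. a k + b k) \<in> Hspace s" "Hnorm s (\<lambda>k. a k + b k) \<le> Hnorm s a + Hnorm s b"
    using Hnorm_leI[OF *] by auto
qed

lemma Hspace_scale:
  assumes "a \<in> Hspace s" shows "(\<lambda>k. c * a k) \<in> Hspace s"
  by (rule Hnorm_leI(1)[where B="cmod c * Hnorm s a"])
     (auto simp: pnorm_scale intro!: mult_left_mono pnorm_le_Hnorm assms)

lemma Hspace_diff:
  assumes "a \<in> Hspace s" "b \<in> Hspace s" shows "(\<lambda>k. a k - b k) \<in> Hspace s"
  using Hspace_add(1)[OF assms(1) Hspace_scale[OF assms(2), of "-1"]] by simp

lemma Hspace_mono:
  assumes "a \<in> Hspace s" "\<And>k. cmod (b k) \<le> cmod (a k)"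
  shows "b \<in> Hspace s" "Hnorm s b \<le> Hnorm s a"
proof -
  have *: "pnorm s F b \<le> Hnorm s a" if "finite F" for F
    using pnorm_mono[of F b a s] pnorm_le_Hnorm[OF assms(1) that] assms(2) by force
  show "b \<in> Hspace s" "Hnorm s b \<le> Hnorm s a" using Hnorm_leI[OF *] by auto
qed

lemma coefficient_le_Hnorm:
  assumes "a \<in> Hspace s" shows "bracket s k * cmod (a k) \<le> Hnorm s a"
  using coefficient_le_pnorm[of "{k}" k s a] pnorm_le_Hnorm[OF assms, of "{k}"] by simp

lemma tendsto_coefficient:
  assumes "((\<lambda>x. Hnorm s (f x)) \<longlongrightarrow> 0) F" "\<And>x. f x \<in> Hspace s"
  shows "((\<lambda>x. f x k) \<longlongrightarrow> 0) F"
proof -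
  have "((\<lambda>x. Hnorm s (f x) / bracket s k) \<longlongrightarrow> 0) F"
    using tendsto_divide[OF assms(1) tendsto_const[of "bracket s k"]] bracket_pos[of s k] by simp
  moreover have "cmod (f x k) \<le> Hnorm s (f x) / bracket s k" for x
    using coefficient_le_Hnorm[OF assms(2)] by (simp add: pos_le_divide_eq mult.commute)
  ultimately show ?thesis
    by (intro Lim_null_comparison[of "\<lambda>x. f x k" _ F] always_eventually) auto
qed

definition modes :: "nat \<Rightarrow> int set" where "modes J = {0..int J}"

lemma finite_modes [simp]: "finite (modes J)" by (simp add: modes_def)

lemma sum_modes: "sum f (modes J) = (\<Sum>n\<le>J. f (int n))"
proof -
  have "modes J = int ` {..J}"
    unfolding modes_def using image_int_atLeastAtMost[of 0 J] by (simp add: atMost_atLeast0)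
  then show ?thesis by (simp add: sum.reindex)
qed

text \<open>
  For \<open>S = modes J\<close> this is the tail of a series supported on nonnegative frequencies, for a singleton
  the deviation from a single mode.
\<close>

definition without :: "int set \<Rightarrow> fseries \<Rightarrow> fseries" where
  "without S a = (\<lambda>k. if k \<in> S then 0 else a k)"

lemma without_Hspace:
  assumes "a \<in> Hspace s" shows "without S a \<in> Hspace s" "Hnorm s (without S a) \<le> Hnorm s a"
  using Hspace_mono[OF assms, of "without S a"] by (auto simp: without_def)

text \<open>
  The absence of negative frequencies makes the boxes \<^term>\<open>modes J\<close> exhaust the support.
\<close>

lemma Hnorm_tail_tendsto_0:
  assumes a: "a \<in> Hspace s" and supp: "\<And>k. k < 0 \<Longrightarrow> a k = 0"
  shows "(\<lambda>J. Hnorm s (without (modes J) a)) \<longlonglongrightarrow> 0"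
proof (rule LIMSEQ_I)
  fix e :: real assume e: "e > 0"
  define f where "f k = (bracket s k)\<^sup>2 * (cmod (a k))\<^sup>2" for k
  have summ: "f summable_on UNIV"
    using a by (simp add: f_def[abs_def] Hspace_def bracket_square)
  then have "(sum f \<longlongrightarrow> infsum f UNIV) (finite_subsets_at_top UNIV)"
    using has_sum_def has_sum_infsum by blast
  then have "\<forall>\<^sub>F F in finite_subsets_at_top UNIV. dist (sum f F) (infsum f UNIV) < (e/2)\<^sup>2"
    using e by (intro tendstoD) auto
  then obtain F0 where F0: "finite F0" "\<And>F. finite F \<Longrightarrow> F0 \<subseteq> F \<Longrightarrow> dist (sum f F) (infsum f UNIV) < (e/2)\<^sup>2"
    unfolding eventually_finite_subsets_at_top by auto
  obtain J0 where J0: "\<And>k. k \<in> F0 \<Longrightarrow> k \<le> int J0"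
  proof (rule that[of "nat (Max F0)"])
    fix k assume "k \<in> F0"
    then have "k \<le> Max F0" using F0(1) by simp
    then show "k \<le> int (nat (Max F0))" by linarith
  qed
  have "Hnorm s (without (modes J) a) \<le> e/2" if "J \<ge> J0" for J
  proof (rule Hnorm_leI(2))
    fix F :: "int set" assume F: "finite F"
    let ?F = "F - modes J" and ?G = "F0 \<union> modes J"
    have "(pnorm s F (without (modes J) a))\<^sup>2 = sum f ?F"
      unfolding pnorm_square f_def using F
      by (intro sum.mono_neutral_cong_right) (auto simp: without_def)
    moreover have "sum f (?F \<union> modes J) = sum f ?F + sum f (modes J)"
      using F by (intro sum.union_disjoint) auto
    moreover have "sum f (modes J) = sum f ?G"
    proof (rule sum.mono_neutral_left)
      show "\<forall>i\<in>?G - modes J. f i = 0"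
      proof
        fix i assume i: "i \<in> ?G - modes J"
        then have "i \<le> int J" using J0[of i] that by force
        with i have "i < 0" by (auto simp: modes_def)
        then show "f i = 0" by (simp add: f_def supp)
      qed
    qed (use F0 in auto)
    moreover have "sum f (?F \<union> modes J) \<le> infsum f UNIV"
      using F summ by (intro finite_sum_le_infsum) (auto simp: f_def)
    moreover have "infsum f UNIV - sum f ?G < (e/2)\<^sup>2"
      using F0(2)[of ?G] F0(1) by (auto simp: dist_real_def abs_less_iff)
    ultimately have "(pnorm s F (without (modes J) a))\<^sup>2 \<le> (e/2)\<^sup>2" by linarith
    then show "pnorm s F (without (modes J) a) \<le> e/2"
      by (rule power2_le_imp_le) (use e in simp)
  qed
  then have "norm (Hnorm s (without (modes J) a) - 0) < e" if "J \<ge> J0" for J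
    using that e by fastforce
  then show "\<exists>no. \<forall>n\<ge>no. norm (Hnorm s (without (modes n) a) - 0) < e"
    by blast
qed

section \<open>The trilinear estimate\<close>

definition Sinv :: real where "Sinv = (\<Sum>n::nat. 1 / (1 + (real n)\<^sup>2))"

lemma summable_Sinv: "summable (\<lambda>n::nat. 1 / (1 + (real n)\<^sup>2))"
proof (rule summable_comparison_test')
  show "summable (\<lambda>n. inverse (real n ^ 2))" by (rule inverse_power_summable) simp
  fix n :: nat assume "n \<ge> 1"
  then show "norm (1 / (1 + (real n)\<^sup>2)) \<le> inverse (real n ^ 2)"
    by (auto simp: field_simps add_pos_nonneg)
qed

lemma Sinv_ge_1: "Sinv \<ge> 1"
  unfolding Sinv_def using sum_le_suminf[OF summable_Sinv, of "{0}"] by simp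

lemma sum_bracket_inverse_le:
  assumes "s \<ge> 1" "finite B" "B \<subseteq> {0..}"
  shows "(\<Sum>k\<in>B. 1 / (bracket s k)\<^sup>2) \<le> Sinv"
proof -
  have "(\<Sum>k\<in>B. 1 / (bracket s k)\<^sup>2) \<le> (\<Sum>k\<in>B. 1 / (1 + (real_of_int k)\<^sup>2))"
    using one_plus_square_le_bracket[OF assms(1)]
    by (intro sum_mono divide_left_mono mult_pos_pos) (auto intro: add_pos_nonneg)
  also have "\<dots> = (\<Sum>n\<in>nat ` B. 1 / (1 + (real n)\<^sup>2))"
    using assms(3) by (subst sum.reindex) (auto simp: inj_on_def subset_iff eq_nat_nat_iff intro!: sum.cong)
  also have "\<dots> \<le> Sinv"
    unfolding Sinv_def using assms(2) by (intro sum_le_suminf summable_Sinv) auto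
  finally show ?thesis .
qed

text \<open>
  The embedding of \<open>H\<^sup>s\<close> into the Wiener algebra, from Cauchy-Schwarz against \<open>1 / bracket s\<close>.
\<close>

lemma sum_cmod_le_pnorm:
  assumes "s \<ge> 1" "finite B" "B \<subseteq> {0..}"
  shows "(\<Sum>k\<in>B. cmod (a k)) \<le> sqrt Sinv * pnorm s B a"
proof -
  have "(\<Sum>k\<in>B. cmod (a k)) = (\<Sum>k\<in>B. \<bar>1 / bracket s k\<bar> * \<bar>bracket s k * cmod (a k)\<bar>)"
    by (intro sum.cong) (auto simp: abs_mult)
  also have "\<dots> \<le> L2_set (\<lambda>k. 1 / bracket s k) B * pnorm s B a"
    unfolding pnorm_def by (rule L2_set_mult_ineq)
  also have "L2_set (\<lambda>k. 1 / bracket s k) B \<le> sqrt Sinv"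
    unfolding L2_set_def using sum_bracket_inverse_le[OF assms] by (simp add: power_divide)
  finally show ?thesis by (simp add: mult_right_mono)
qed

text \<open>
  Two factors suffice although three frequencies interact: with \<open>p + q = r + k\<close> and \<open>r \<ge> 0\<close> the
  output frequency \<open>k\<close> is at most \<open>p + q\<close>.
\<close>

lemma bracket_sum_le:
  assumes "s \<ge> 1" "0 \<le> k" "0 \<le> p" "0 \<le> q" "k \<le> p + q"
  shows "(bracket s k)\<^sup>2 \<le> 4 powr s * ((bracket s p)\<^sup>2 + (bracket s q)\<^sup>2)"
proof -
  define x where "x = max p q"
  have "real_of_int k \<le> 2 * real_of_int x"
    using assms by (simp add: x_def)
  then have "(real_of_int k)\<^sup>2 \<le> (2 * real_of_int x)\<^sup>2"
    using assms by (intro power_mono) auto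
  then have "(1 + (real_of_int k)\<^sup>2) powr s \<le> (4 * (1 + (real_of_int x)\<^sup>2)) powr s"
    using assms(1) by (intro powr_mono2) (auto simp: power2_eq_square)
  also have "\<dots> = 4 powr s * (bracket s x)\<^sup>2"
    by (subst powr_mult) (auto simp: bracket_square)
  also have "(bracket s x)\<^sup>2 \<le> (bracket s p)\<^sup>2 + (bracket s q)\<^sup>2"
    by (auto simp: x_def max_def)
  finally show ?thesis by (simp add: bracket_square[symmetric])
qed

definition res3 :: "int set \<Rightarrow> int \<Rightarrow> (int \<times> int \<times> int) set" where
  "res3 B k = {(p, q, r). p \<in> B \<and> q \<in> B \<and> r \<in> B \<and> p + q = r + k}"

text \<open>
  The coefficient of frequency \<open>k\<close> of the product of the trigonometric polynomials with coefficients
  \<open>a\<close>, \<open>b\<close> on \<open>B\<close> and the conjugate of the one with coefficients \<open>c\<close>.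
\<close>

definition tri :: "int set \<Rightarrow> fseries \<Rightarrow> fseries \<Rightarrow> fseries \<Rightarrow> fseries" where
  "tri B a b c k = (\<Sum>(p, q, r) \<in> res3 B k. a p * b q * cnj (c r))"

lemma finite_res3 [simp]: "finite B \<Longrightarrow> finite (res3 B k)"
  by (rule finite_subset[of _ "B \<times> B \<times> B"]) (auto simp: res3_def)

lemma tri_add1: "tri B (\<lambda>k. a k + a' k) b c k = tri B a b c k + tri B a' b c k"
  and tri_add2: "tri B a (\<lambda>k. b k + b' k) c k = tri B a b c k + tri B a b' c k"
  and tri_add3: "tri B a b (\<lambda>k. c k + c' k) k = tri B a b c k + tri B a b c' k"
  by (simp_all add: tri_def case_prod_beta ring_distribs flip: sum.distrib)

definition tri_const :: "real \<Rightarrow> real" where "tri_const s = sqrt (2 * 4 powr s) * Sinv"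

lemma tri_const_pos: "tri_const s > 0"
  using Sinv_ge_1 by (simp add: tri_const_def)

text \<open>
  The Schur-type bound behind the trilinear estimate. The output weight is absorbed by that of \<open>p\<close> or
  of \<open>q\<close>; the two remaining frequencies determine the triple, and their weights have summable
  inverse squares.
\<close>

lemma sum_res3_le:
  assumes s: "s \<ge> 1" and B: "finite B" "B \<subseteq> {0..}" and k: "k \<ge> 0"
  shows "(bracket s k)\<^sup>2 * (\<Sum>(p, q, r) \<in> res3 B k. (1 / (bracket s p * bracket s q * bracket s r))\<^sup>2)
           \<le> (tri_const s)\<^sup>2"
proof -
  let ?o = "\<lambda>k. 1 / (bracket s k)\<^sup>2"
  have pair: "(\<Sum>x \<in> res3 B k. ?o (f x) * ?o (g x)) \<le> Sinv\<^sup>2"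
    if inj: "inj_on (\<lambda>x. (f x, g x)) (res3 B k)" and im: "\<And>x. x \<in> res3 B k \<Longrightarrow> f x \<in> B \<and> g x \<in> B"
    for f g :: "int \<times> int \<times> int \<Rightarrow> int"
  proof -
    have "(\<Sum>x \<in> res3 B k. ?o (f x) * ?o (g x))
        = (\<Sum>(y, z) \<in> (\<lambda>x. (f x, g x)) ` res3 B k. ?o y * ?o z)"
      by (simp add: sum.reindex[OF inj])
    also have "\<dots> \<le> (\<Sum>(y, z) \<in> B \<times> B. ?o y * ?o z)"
      using B im by (intro sum_mono2) auto
    also have "\<dots> = (\<Sum>y\<in>B. ?o y) * (\<Sum>z\<in>B. ?o z)"
      by (simp add: sum_product sum.cartesian_product)
    also have "\<dots> \<le> Sinv * Sinv"
      using sum_bracket_inverse_le[OF s B] Sinv_ge_1 by (intro mult_mono sum_nonneg) auto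
    finally show ?thesis by (simp add: power2_eq_square)
  qed
  have "(bracket s k)\<^sup>2 * (\<Sum>(p, q, r) \<in> res3 B k. (1 / (bracket s p * bracket s q * bracket s r))\<^sup>2)
      \<le> (\<Sum>(p, q, r) \<in> res3 B k. 4 powr s * (?o q * ?o r + ?o p * ?o r))"
    unfolding sum_distrib_left
  proof (rule sum_mono, clarify)
    fix p q r assume "(p, q, r) \<in> res3 B k"
    then have "p \<ge> 0" "q \<ge> 0" "k \<le> p + q" using B by (auto simp: res3_def)
    then have "(bracket s k)\<^sup>2 * (1 / (bracket s p * bracket s q * bracket s r))\<^sup>2
        \<le> 4 powr s * ((bracket s p)\<^sup>2 + (bracket s q)\<^sup>2) * (1 / (bracket s p * bracket s q * bracket s r))\<^sup>2"
      using bracket_sum_le[OF s k] by (intro mult_right_mono) auto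
    also have "\<dots> = 4 powr s * (?o q * ?o r + ?o p * ?o r)"
      by (simp add: divide_simps power_mult_distrib)
    finally show "(bracket s k)\<^sup>2 * (1 / (bracket s p * bracket s q * bracket s r))\<^sup>2 \<le> \<dots>" .
  qed
  also have "\<dots> = 4 powr s * ((\<Sum>x \<in> res3 B k. ?o (fst (snd x)) * ?o (snd (snd x)))
                              + (\<Sum>x \<in> res3 B k. ?o (fst x) * ?o (snd (snd x))))"
    by (simp add: case_prod_beta sum.distrib[symmetric] sum_distrib_left[symmetric])
  also have "\<dots> \<le> 4 powr s * (Sinv\<^sup>2 + Sinv\<^sup>2)"
    by (intro mult_left_mono add_mono pair) (auto simp: inj_on_def res3_def)
  finally show ?thesis by (simp add: tri_const_def power_mult_distrib)
qed

text \<open>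
  The space \<open>H\<^sup>s\<close>, \<open>s \<ge> 1\<close>, is an algebra. Cauchy-Schwarz on the fibre of triples with output \<open>k\<close> splits
  off the factor bounded in \<open>sum_res3_le\<close>; what remains sums over all \<open>k\<close> to a product of norms.
\<close>

lemma pnorm_tri_le:
  assumes s: "s \<ge> 1" and B: "finite B" "B \<subseteq> {0..}" and L: "finite L" "L \<subseteq> {0..}"
  shows "pnorm s L (tri B a b c) \<le> tri_const s * (pnorm s B a * pnorm s B b * pnorm s B c)"
proof (rule power2_le_imp_le)
  let ?al = "\<lambda>a k. (bracket s k)\<^sup>2 * (cmod (a k))\<^sup>2"
  let ?w = "\<lambda>(p, q, r). 1 / (bracket s p * bracket s q * bracket s r)"
  let ?f = "\<lambda>(p, q, r). (bracket s p * bracket s q * bracket s r) * (cmod (a p) * cmod (b q) * cmod (c r))"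
  let ?g = "\<lambda>(p, q, r). ?al a p * ?al b q * ?al c r"
  have single: "(bracket s k)\<^sup>2 * (cmod (tri B a b c k))\<^sup>2 \<le> (tri_const s)\<^sup>2 * sum ?g (res3 B k)"
    if "k \<in> L" for k
  proof -
    have "cmod (tri B a b c k) \<le> (\<Sum>x \<in> res3 B k. ?w x * ?f x)"
      unfolding tri_def
    proof (rule sum_norm_le, clarify)
      fix p q r
      have "bracket s p * bracket s q * bracket s r \<noteq> 0"
        by simp
      then show "cmod (a p * b q * cnj (c r))
         \<le> 1 / (bracket s p * bracket s q * bracket s r) *
           (bracket s p * bracket s q * bracket s r * (cmod (a p) * cmod (b q) * cmod (c r)))"
        by (simp add: norm_mult)
    qed
    then have "(cmod (tri B a b c k))\<^sup>2 \<le> (\<Sum>x \<in> res3 B k. ?w x * ?f x)\<^sup>2"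
      by (intro power_mono) auto
    also have "\<dots> \<le> (\<Sum>x \<in> res3 B k. (?w x)\<^sup>2) * (\<Sum>x \<in> res3 B k. (?f x)\<^sup>2)"
      by (rule Cauchy_Schwarz_ineq_sum)
    also have "(\<Sum>x \<in> res3 B k. (?f x)\<^sup>2) = sum ?g (res3 B k)"
      by (intro sum.cong) (auto simp: power_mult_distrib)
    finally have "(bracket s k)\<^sup>2 * (cmod (tri B a b c k))\<^sup>2
        \<le> (bracket s k)\<^sup>2 * (\<Sum>x \<in> res3 B k. (?w x)\<^sup>2) * sum ?g (res3 B k)"
      by (simp add: mult_left_mono mult.assoc)
    also have "\<dots> \<le> (tri_const s)\<^sup>2 * sum ?g (res3 B k)"
      using sum_res3_le[OF s B, of k] that L(2)
      by (intro mult_right_mono sum_nonneg) (auto simp: case_prod_beta)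
    finally show ?thesis .
  qed
  have "(\<Sum>k\<in>L. sum ?g (res3 B k)) = sum ?g (\<Union>k\<in>L. res3 B k)"
  proof (rule sum.UNION_disjoint[symmetric])
    show "\<forall>i\<in>L. finite (res3 B i)" using B by simp
    show "\<forall>i\<in>L. \<forall>j\<in>L. i \<noteq> j \<longrightarrow> res3 B i \<inter> res3 B j = {}" by (auto simp: res3_def)
  qed (rule L)
  also have "\<dots> \<le> sum ?g (B \<times> B \<times> B)"
    using B(1) by (intro sum_mono2) (auto simp: res3_def)
  finally have all: "(\<Sum>k\<in>L. sum ?g (res3 B k)) \<le> sum ?g (B \<times> B \<times> B)" .
  have "(pnorm s L (tri B a b c))\<^sup>2 \<le> (tri_const s)\<^sup>2 * (\<Sum>k\<in>L. sum ?g (res3 B k))"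
    unfolding pnorm_square sum_distrib_left[of _ _ L] by (rule sum_mono) (rule single)
  also have "\<dots> \<le> (tri_const s)\<^sup>2 * sum ?g (B \<times> B \<times> B)"
    by (rule mult_left_mono[OF all]) simp
  also have "sum ?g (B \<times> B \<times> B) = sum (?al a) B * (sum (?al b) B * sum (?al c) B)"
  proof -
    have "sum ?g (B \<times> B \<times> B) = (\<Sum>p\<in>B. \<Sum>q\<in>B. \<Sum>r\<in>B. ?al a p * (?al b q * ?al c r))"
      unfolding sum.cartesian_product by (rule sum.cong) (auto simp: mult.assoc)
    also have "\<dots> = sum (?al a) B * (sum (?al b) B * sum (?al c) B)"
      by (simp only: sum_distrib_left[symmetric] sum_distrib_right[symmetric])
    finally show ?thesis .
  qed
  finally show "(pnorm s L (tri B a b c))\<^sup>2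
      \<le> (tri_const s * (pnorm s B a * pnorm s B b * pnorm s B c))\<^sup>2"
    by (simp only: power_mult_distrib pnorm_square mult.assoc)
  show "0 \<le> tri_const s * (pnorm s B a * pnorm s B b * pnorm s B c)"
    using less_imp_le[OF tri_const_pos[of s]] by (intro mult_nonneg_nonneg pnorm_nonneg)
qed

section \<open>Resonant quadruples and truncated conservation laws\<close>

definition res4 :: "int set \<Rightarrow> (int \<times> int \<times> int \<times> int) set" where
  "res4 B = {(p, q, r, l). p \<in> B \<and> q \<in> B \<and> r \<in> B \<and> l \<in> B \<and> p + q = r + l}"

text \<open>
  With all four arguments equal this is the mean value of \<open>|f|\<^sup>4\<close> for the trigonometric polynomial \<open>f\<close>
  with these coefficients.
\<close>

definition quart :: "int set \<Rightarrow> fseries \<Rightarrow> fseries \<Rightarrow> fseries \<Rightarrow> fseries \<Rightarrow> complex" where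
  "quart B a b c d = (\<Sum>(p, q, r, l) \<in> res4 B. a p * b q * cnj (c r) * cnj (d l))"

lemma sum_cnj_tri:
  assumes "finite B"
  shows "(\<Sum>l\<in>B. cnj (d l) * tri B a b c l) = quart B a b c d"
proof -
  have "(\<Sum>l\<in>B. cnj (d l) * tri B a b c l)
      = (\<Sum>(l, p, q, r) \<in> Sigma B (res3 B). cnj (d l) * (a p * b q * cnj (c r)))"
    using assms by (simp add: tri_def sum_distrib_left case_prod_beta sum.Sigma)
  also have "\<dots> = quart B a b c d"
    unfolding quart_def
    by (rule sum.reindex_bij_witness[where i = "\<lambda>(p, q, r, l). (l, p, q, r)" and j = "\<lambda>(l, p, q, r). (p, q, r, l)"])
       (auto simp: res3_def res4_def)
  finally show ?thesis .
qed

lemma quart_swap_left: "quart B a b c d = quart B b a c d"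
  unfolding quart_def
  by (rule sum.reindex_bij_witness[where i = "\<lambda>(p, q, r, l). (q, p, r, l)" and j = "\<lambda>(p, q, r, l). (q, p, r, l)"])
     (auto simp: res4_def)

lemma quart_swap_right: "quart B a b c d = quart B a b d c"
  unfolding quart_def
  by (rule sum.reindex_bij_witness[where i = "\<lambda>(p, q, r, l). (p, q, l, r)" and j = "\<lambda>(p, q, r, l). (p, q, l, r)"])
     (auto simp: res4_def)

lemma cnj_quart: "cnj (quart B a b c d) = quart B c d a b"
  unfolding quart_def cnj_sum
  by (rule sum.reindex_bij_witness[where i = "\<lambda>(p, q, r, l). (r, l, p, q)" and j = "\<lambda>(p, q, r, l). (r, l, p, q)"])
     (auto simp: res4_def)

text \<open>
  The algebraic source of mass (\<open>\<phi> = 1\<close>) and momentum (\<open>\<phi> = k\<close>) conservation. Exchanging the two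
  conjugated frequencies, and conjugating, moves the weight to any of the four positions; the
  imaginary part is thus a multiple of \<open>\<phi> r + \<phi> l - \<phi> p - \<phi> q\<close>, which vanishes on resonant quadruples
  for affine \<open>\<phi>\<close>.
\<close>

lemma Im_affine_weighted_pairing_eq_0:
  fixes \<alpha> \<beta> :: real
  assumes "finite B"
  shows "(\<Sum>l\<in>B. (\<alpha> + \<beta> * of_int l) * Im (cnj (a l) * tri B a a a l)) = 0"
proof -
  define \<phi> where "\<phi> l = \<alpha> + \<beta> * real_of_int l" for l
  define \<phi>a where "\<phi>a l = of_real (\<phi> l) * a l" for l
  have sum: "(\<Sum>l\<in>B. \<phi> l * Im (cnj (a l) * tri B a a a l)) = Im (quart B a a a \<phi>a)"
    unfolding sum_cnj_tri[OF assms, symmetric] Im_sum \<phi>a_def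
    by (intro sum.cong) (simp_all add: algebra_simps)
  have "quart B a a a \<phi>a + quart B a a \<phi>a a = quart B \<phi>a a a a + quart B a \<phi>a a a"
    unfolding quart_def sum.distrib[symmetric]
  proof (rule sum.cong, simp, clarify)
    fix p q r l assume "(p, q, r, l) \<in> res4 B"
    then have "\<phi> r + \<phi> l = \<phi> p + \<phi> q"
      by (auto simp: res4_def \<phi>_def simp flip: distrib_left of_int_add)
    then have "complex_of_real (\<phi> r) + of_real (\<phi> l) = of_real (\<phi> p) + of_real (\<phi> q)"
      by (simp flip: of_real_add)
    then show "a p * a q * cnj (a r) * cnj (\<phi>a l) + a p * a q * cnj (\<phi>a r) * cnj (a l)
        = \<phi>a p * a q * cnj (a r) * cnj (a l) + a p * \<phi>a q * cnj (a r) * cnj (a l)"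
      unfolding \<phi>a_def by simp algebra
  qed
  moreover have "quart B \<phi>a a a a = cnj (quart B a a a \<phi>a)" "quart B a \<phi>a a a = cnj (quart B a a a \<phi>a)"
    "quart B a a \<phi>a a = quart B a a a \<phi>a"
    using quart_swap_left[of B \<phi>a a a a] quart_swap_right[of B a a \<phi>a a] cnj_quart[of B a a a \<phi>a] by auto
  ultimately have "quart B a a a \<phi>a = cnj (quart B a a a \<phi>a)" by simp
  then have "Im (quart B a a a \<phi>a) = 0" by (metis cnj.simps(2) equal_neg_zero)
  with sum show ?thesis by (simp add: \<phi>_def)
qed

lemma has_real_derivative_weighted_mass:
  assumes "\<And>k. k \<in> B \<Longrightarrow> ((\<lambda>\<tau>. a \<tau> k) has_vector_derivative a' k) (at t)"
  shows "((\<lambda>\<tau>. \<Sum>k\<in>B. \<phi> k * (cmod (a \<tau> k))\<^sup>2) has_real_derivative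
           (\<Sum>k\<in>B. \<phi> k * (2 * Re (cnj (a t k) * a' k)))) (at t)"
proof (intro DERIV_sum DERIV_cmult)
  fix k assume "k \<in> B"
  note d = assms[OF this]
  have R: "((\<lambda>\<tau>. Re (a \<tau> k)) has_real_derivative Re (a' k)) (at t)"
    and I: "((\<lambda>\<tau>. Im (a \<tau> k)) has_real_derivative Im (a' k)) (at t)"
    using bounded_linear.has_vector_derivative[OF bounded_linear_Re d]
      bounded_linear.has_vector_derivative[OF bounded_linear_Im d]
    by (simp_all add: has_real_derivative_iff_has_vector_derivative)
  show "((\<lambda>\<tau>. (cmod (a \<tau> k))\<^sup>2) has_real_derivative 2 * Re (cnj (a t k) * a' k)) (at t)"
    unfolding cmod_power2
    by (rule derivative_eq_intros R I refl)+ (simp add: algebra_simps)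
qed

text \<open>
  By the symmetries of the form, each of the four factors contributes the same real part.
\<close>

lemma has_real_derivative_quart:
  assumes "\<And>k. k \<in> B \<Longrightarrow> ((\<lambda>\<tau>. a \<tau> k) has_vector_derivative a' k) (at t)"
  shows "((\<lambda>\<tau>. Re (quart B (a \<tau>) (a \<tau>) (a \<tau>) (a \<tau>))) has_real_derivative
           4 * Re (quart B (a t) (a t) (a t) a')) (at t)"
proof -
  let ?a = "a t"
  let ?D = "quart B a' ?a ?a ?a + quart B ?a a' ?a ?a + quart B ?a ?a a' ?a + quart B ?a ?a ?a a'"
  have "((\<lambda>\<tau>. quart B (a \<tau>) (a \<tau>) (a \<tau>) (a \<tau>)) has_vector_derivative ?D) (at t)"
    unfolding quart_def sum.distrib[symmetric]
  proof (rule has_vector_derivative_sum, clarify)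
    fix p q r l assume "(p, q, r, l) \<in> res4 B"
    then have "p \<in> B" "q \<in> B" "r \<in> B" "l \<in> B" by (auto simp: res4_def)
    note d = assms[OF this(1)] assms[OF this(2)]
      assms[OF this(3), THEN has_vector_derivative_cnj] assms[OF this(4), THEN has_vector_derivative_cnj]
    show "((\<lambda>\<tau>. a \<tau> p * a \<tau> q * cnj (a \<tau> r) * cnj (a \<tau> l)) has_vector_derivative
       a' p * ?a q * cnj (?a r) * cnj (?a l) + ?a p * a' q * cnj (?a r) * cnj (?a l) +
       ?a p * ?a q * cnj (a' r) * cnj (?a l) + ?a p * ?a q * cnj (?a r) * cnj (a' l)) (at t)"
      by (rule has_vector_derivative_eq_rhs,
          (rule has_vector_derivative_mult d)+) (simp add: algebra_simps)
  qed
  from bounded_linear.has_vector_derivative[OF bounded_linear_Re this]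
  have "((\<lambda>\<tau>. Re (quart B (a \<tau>) (a \<tau>) (a \<tau>) (a \<tau>))) has_real_derivative Re ?D) (at t)"
    by (simp add: has_real_derivative_iff_has_vector_derivative)
  moreover have "quart B ?a ?a a' ?a = quart B ?a ?a ?a a'" by (rule quart_swap_right)
  moreover have "quart B ?a a' ?a ?a = cnj (quart B ?a ?a ?a a')"
    using cnj_quart[of B ?a ?a ?a a'] by simp
  moreover have "quart B a' ?a ?a ?a = cnj (quart B ?a ?a ?a a')"
    using cnj_quart[of B ?a ?a ?a a'] quart_swap_left[of B a' ?a ?a ?a] by simp
  ultimately show ?thesis by (simp add: add_ac)
qed

text \<open>
  For a system in which \<open>R\<close> perturbs the finite-dimensional Hamiltonian flow on the modes of \<open>B\<close>, mass
  and energy vary only through \<open>R\<close>. The energy uses the weight \<open>(k - m)\<^sup>2\<close> in place of \<open>k\<^sup>2\<close>: the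
  two differ by an affine function of \<open>k\<close>, that is, by a combination of mass and momentum.
\<close>

lemma truncated_conservation_laws:
  fixes \<nu> :: real and m :: int
  assumes B: "finite B"
    and deriv: "\<And>k. k \<in> B \<Longrightarrow> ((\<lambda>\<tau>. a \<tau> k) has_vector_derivative a' k) (at t)"
    and eq: "\<And>k. k \<in> B \<Longrightarrow> a' k = - \<i> * (of_real (\<nu> * (of_int k)\<^sup>2) * a t k + tri B (a t) (a t) (a t) k + R k)"
  shows "((\<lambda>\<tau>. \<Sum>k\<in>B. (cmod (a \<tau> k))\<^sup>2) has_real_derivative
           2 * (\<Sum>k\<in>B. Im (cnj (a t k) * R k))) (at t)" (is ?mass)
    and "((\<lambda>\<tau>. \<nu> * (\<Sum>k\<in>B. (of_int (k - m))\<^sup>2 * (cmod (a \<tau> k))\<^sup>2)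
               + Re (quart B (a \<tau>) (a \<tau>) (a \<tau>) (a \<tau>)) / 2) has_real_derivative
           2 * \<nu> * (\<Sum>k\<in>B. (of_int (k - m))\<^sup>2 * Im (cnj (a t k) * R k))
           + 2 * (\<Sum>k\<in>B. Im (cnj (tri B (a t) (a t) (a t) k) * R k))) (at t)" (is ?energy)
proof -
  let ?a = "a t" and ?T = "tri B (a t) (a t) (a t)"
  let ?I = "\<lambda>k. Im (cnj (?a k) * ?T k)" and ?J = "\<lambda>k. Im (cnj (?a k) * R k)"
  have pair: "Re (cnj (?a k) * a' k) = ?I k + ?J k" if "k \<in> B" for k
    unfolding eq[OF that] by (simp add: algebra_simps)
  have zero: "sum ?I B = 0"
    using Im_affine_weighted_pairing_eq_0[OF B, of 1 0 ?a] by simp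
  have "((\<lambda>\<tau>. \<Sum>k\<in>B. 1 * (cmod (a \<tau> k))\<^sup>2) has_real_derivative
           (\<Sum>k\<in>B. 1 * (2 * Re (cnj (?a k) * a' k)))) (at t)"
    by (intro has_real_derivative_weighted_mass deriv)
  also have "(\<Sum>k\<in>B. 1 * (2 * Re (cnj (?a k) * a' k))) = 2 * (sum ?I B + sum ?J B)"
    unfolding sum_distrib_left sum.distrib[symmetric] by (intro sum.cong refl) (simp only: pair mult_1 distrib_left)
  finally show ?mass using zero by simp
  have zero': "(\<Sum>k\<in>B. (of_int (k - m))\<^sup>2 * ?I k) = (\<Sum>k\<in>B. (of_int k)\<^sup>2 * ?I k)"
  proof -
    have "(\<Sum>k\<in>B. (of_int (k - m))\<^sup>2 * ?I k) - (\<Sum>k\<in>B. (of_int k)\<^sup>2 * ?I k)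
        = (\<Sum>k\<in>B. ((of_int m)\<^sup>2 + (- 2 * of_int m) * of_int k) * ?I k)"
      unfolding sum_subtractf[symmetric] by (intro sum.cong) (simp_all add: algebra_simps power2_eq_square)
    also have "\<dots> = 0" by (rule Im_affine_weighted_pairing_eq_0[OF B])
    finally show ?thesis by simp
  qed
  have "Re (quart B ?a ?a ?a a') = (\<Sum>k\<in>B. - \<nu> * ((of_int k)\<^sup>2 * ?I k) + Im (cnj (?T k) * R k))"
    unfolding sum_cnj_tri[OF B, symmetric] Re_sum
    by (intro sum.cong) (simp_all add: eq algebra_simps)
  also have "\<dots> = - \<nu> * (\<Sum>k\<in>B. (of_int k)\<^sup>2 * ?I k) + (\<Sum>k\<in>B. Im (cnj (?T k) * R k))"
    by (simp only: sum.distrib sum_distrib_left)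
  finally have quart: "4 * Re (quart B ?a ?a ?a a') / 2
      = 2 * (- \<nu> * (\<Sum>k\<in>B. (of_int k)\<^sup>2 * ?I k) + (\<Sum>k\<in>B. Im (cnj (?T k) * R k)))" by simp
  have weighted: "(\<Sum>k\<in>B. (of_int (k - m))\<^sup>2 * (2 * Re (cnj (?a k) * a' k)))
      = 2 * ((\<Sum>k\<in>B. (of_int k)\<^sup>2 * ?I k) + (\<Sum>k\<in>B. (of_int (k - m))\<^sup>2 * ?J k))"
    unfolding zero'[symmetric] sum_distrib_left sum.distrib[symmetric]
    by (intro sum.cong refl) (simp only: pair distrib_left mult.left_commute)
  have "((\<lambda>\<tau>. \<nu> * (\<Sum>k\<in>B. (of_int (k - m))\<^sup>2 * (cmod (a \<tau> k))\<^sup>2)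
               + Re (quart B (a \<tau>) (a \<tau>) (a \<tau>) (a \<tau>)) / 2) has_real_derivative
           \<nu> * (\<Sum>k\<in>B. (of_int (k - m))\<^sup>2 * (2 * Re (cnj (?a k) * a' k)))
           + 4 * Re (quart B ?a ?a ?a a') / 2) (at t)"
    by (intro DERIV_add DERIV_cmult DERIV_cdivide has_real_derivative_weighted_mass
        has_real_derivative_quart deriv)
  then show ?energy
    unfolding quart weighted by (simp add: algebra_simps)
qed

section \<open>Fourier coefficients on the circle\<close>

abbreviation circ :: "real measure" where "circ \<equiv> lebesgue_on {0..2 * pi}"

lemma finite_measure_circ: "finite_measure circ"
  by (intro finite_measure_lebesgue_on) simp

lemma set_integrable_iff_integrable_circ:
  fixes f :: "real \<Rightarrow> 'a :: {banach, second_countable_topology}"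
  shows "set_integrable lebesgue {0..2 * pi} f \<longleftrightarrow> integrable circ f"
  unfolding set_integrable_def by (simp add: integrable_restrict_space)

lemma fourier_circ:
  "fourier f k = complex_of_real (1 / (2 * pi)) * (LINT x|circ. f x * e_mode (- k) x)"
  unfolding fourier_def set_lebesgue_integral_def by (simp add: integral_restrict_space)

lemma measurable_circ: "f \<in> borel_measurable lebesgue \<Longrightarrow> f \<in> borel_measurable circ"
  by (rule measurable_restrict_space1)

lemma measurable_lebesgue_continuous:
  fixes f :: "real \<Rightarrow> 'a::real_normed_vector"
  assumes "continuous_on UNIV f" shows "f \<in> borel_measurable lebesgue"
  using borel_measurable_continuous_onI[OF assms] by (simp add: measurable_completion)

lemma integrable_circ_bounded:
  fixes f :: "real \<Rightarrow> 'a :: {banach, second_countable_topology}"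
  assumes "f \<in> borel_measurable lebesgue" "\<And>x. norm (f x) \<le> C"
  shows "integrable circ f"
  using assms by (intro finite_measure.integrable_const_bound[OF finite_measure_circ, of _ C] measurable_circ) auto

lemma integrable_circ_mult_bounded:
  fixes f g :: "real \<Rightarrow> complex"
  assumes "integrable circ f" "g \<in> borel_measurable lebesgue" "\<And>x. cmod (g x) \<le> C"
  shows "integrable circ (\<lambda>x. f x * g x)"
proof (rule Bochner_Integration.integrable_bound)
  show "integrable circ (\<lambda>x. f x * of_real C)" using assms(1) by simp
  show "(\<lambda>x. f x * g x) \<in> borel_measurable circ"
    using assms(1) measurable_circ[OF assms(2)] by (intro borel_measurable_times) auto
  have "0 \<le> C" using assms(3)[of 0] norm_ge_zero[of "g 0"] by linarith
  then show "AE x in circ. norm (f x * g x) \<le> norm (f x * complex_of_real C)"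
    using assms(3) by (intro AE_I2) (simp add: norm_mult mult_left_mono)
qed

lemma e_mode_cis: "e_mode k x = cis (of_int k * x)"
  by (simp add: e_mode_def cis_conv_exp mult.assoc)

lemma e_mode_add: "e_mode (j + k) x = e_mode j x * e_mode k x"
  by (simp add: e_mode_cis cis_mult ring_distribs)

lemma e_mode_0 [simp]: "e_mode 0 x = 1" by (simp add: e_mode_cis)

lemma cnj_e_mode: "cnj (e_mode k x) = e_mode (- k) x"
  by (simp add: e_mode_cis cis_cnj)

lemma norm_e_mode [simp]: "cmod (e_mode k x) = 1" by (simp add: e_mode_cis)

lemma measurable_e_mode [measurable]: "e_mode k \<in> borel_measurable lebesgue"
proof (rule measurable_lebesgue_continuous)
  show "continuous_on UNIV (e_mode k)"
    unfolding e_mode_cis[abs_def] cis_conv_exp by (intro continuous_intros)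
qed

lemma integrable_e_mode_mult:
  "integrable circ f \<Longrightarrow> integrable circ (\<lambda>x. f x * e_mode k x)"
  by (rule integrable_circ_mult_bounded[where C = 1]) auto

lemma fourier_add:
  assumes "integrable circ f" "integrable circ g"
  shows "fourier (\<lambda>x. f x + g x) k = fourier f k + fourier g k"
  using assms by (simp add: fourier_circ ring_distribs integrable_e_mode_mult)

lemma fourier_diff:
  assumes "integrable circ f" "integrable circ g"
  shows "fourier (\<lambda>x. f x - g x) k = fourier f k - fourier g k"
  using assms by (simp add: fourier_circ ring_distribs integrable_e_mode_mult)

lemma fourier_scale: "fourier (\<lambda>x. c * f x) k = c * fourier f k"
  by (simp add: fourier_circ mult.assoc mult.left_commute)

lemma fourier_e_mode_mult: "fourier (\<lambda>x. f x * e_mode j x) k = fourier f (k - j)"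
proof -
  have "f x * e_mode j x * e_mode (- k) x = f x * e_mode (- (k - j)) x" for x
    by (simp add: mult.assoc flip: e_mode_add)
  then show ?thesis by (simp only: fourier_circ)
qed

lemma fourier_e_mode: "fourier (e_mode j) k = (if k = j then 1 else 0)"
proof (cases "k = j")
  case True
  have "(LINT x|circ. e_mode j x * e_mode (- k) x) = (LINT x|circ. 1)"
    using True e_mode_add[of j "-j"] by simp
  also have "\<dots> = 2 * pi"
    by (simp add: measure_restrict_space scaleR_conv_of_real)
  finally show ?thesis using True by (simp add: fourier_circ)
next
  case False
  define n where "n = j - k"
  have n: "n \<noteq> 0" using False by (simp add: n_def)
  have "((\<lambda>x. e_mode n x) has_integral (e_mode n (2 * pi) / (\<i> * of_int n) - e_mode n 0 / (\<i> * of_int n))) {0..2 * pi}"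
  proof (rule fundamental_theorem_of_calculus)
    fix x :: real
    have "((\<lambda>z. exp (\<i> * of_int n * z) / (\<i> * of_int n)) has_field_derivative exp (\<i> * of_int n * of_real x)) (at (of_real x))"
      using n by (auto intro!: derivative_eq_intros)
    then show "((\<lambda>x. e_mode n x / (\<i> * of_int n)) has_vector_derivative e_mode n x) (at x within {0..2 * pi})"
      unfolding e_mode_def by (rule has_vector_derivative_real_field[THEN has_vector_derivative_at_within])
  qed simp
  moreover have "e_mode n (2 * pi) = e_mode n 0"
    using cis_multiple_2pi[of "of_int n"] by (simp add: e_mode_cis mult_ac)
  ultimately have "integral {0..2 * pi} (e_mode n) = 0"
    by (simp add: integral_unique)
  moreover have "set_integrable lebesgue {0..2 * pi} (e_mode n)"
    unfolding set_integrable_iff_integrable_circ by (rule integrable_circ_bounded[where C = 1]) auto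
  ultimately have "(LINT x|circ. e_mode n x) = 0"
    using set_lebesgue_integral_eq_integral(2)[of "{0..2*pi}" "e_mode n"]
    by (simp add: set_lebesgue_integral_def integral_restrict_space)
  then show ?thesis
    using False e_mode_add[of j "- k"] by (simp add: fourier_circ n_def)
qed

text \<open>
  Frequencies \<open>n i\<close> may repeat, so that products of trigonometric polynomials need not be regrouped by
  frequency.
\<close>

lemma fourier_trig_sum:
  assumes "finite I"
  shows "fourier (\<lambda>x. \<Sum>i\<in>I. c i * e_mode (n i) x) k = (\<Sum>i\<in>{i\<in>I. n i = k}. c i)"
proof -
  have int: "integrable circ (\<lambda>x. \<Sum>i\<in>J. c i * e_mode (n i) x)" for J
    by (intro Bochner_Integration.integrable_sum integrable_mult_right)
       (auto intro: integrable_circ_bounded[where C = 1])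
  have "fourier (\<lambda>x. \<Sum>i\<in>I. c i * e_mode (n i) x) k = (\<Sum>i\<in>I. if n i = k then c i else 0)"
    using assms
  proof induction
    case empty
    then show ?case by (simp add: fourier_circ)
  next
    case (insert i J)
    have "integrable circ (\<lambda>x. c i * e_mode (n i) x)" using int[of "{i}"] by simp
    from fourier_add[OF this int[of J], of k] insert show ?case
      by (simp add: fourier_scale fourier_e_mode)
  qed
  also have "\<dots> = (\<Sum>i\<in>{i\<in>I. n i = k}. c i)"
    using assms by (simp add: sum.inter_filter)
  finally show ?thesis .
qed

lemma fourier_dominated_convergence:
  assumes "\<And>J. f J \<in> borel_measurable lebesgue" "g \<in> borel_measurable lebesgue"
    and "\<And>J x. cmod (f J x) \<le> C" "\<And>x. (\<lambda>J. f J x) \<longlonglongrightarrow> g x"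
  shows "(\<lambda>J. fourier (f J) k) \<longlonglongrightarrow> fourier g k"
  unfolding fourier_circ
proof (intro tendsto_mult_left integral_dominated_convergence[where w = "\<lambda>_. C"])
  show "AE x in circ. (\<lambda>J. f J x * e_mode (- k) x) \<longlonglongrightarrow> g x * e_mode (- k) x"
    by (intro AE_I2 tendsto_mult_right assms)
  show "AE x in circ. norm (f J x * e_mode (- k) x) \<le> C" for J
    using assms(3) by (intro AE_I2) (simp add: norm_mult)
  show "integrable circ (\<lambda>_. C)"
    by (rule finite_measure.integrable_const[OF finite_measure_circ])
qed (use assms in \<open>auto intro!: measurable_circ borel_measurable_times\<close>)

section \<open>Uniqueness of Fourier coefficients\<close>

text \<open>
  The class of integrable functions with vanishing coefficients is stable under multiplication by
  \<open>cos\<close> and \<open>sin\<close>, which shift the coefficients. Quantifying over \<open>h\<close> in the induction lets a product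
  of polynomials be treated by multiplying twice.
\<close>

lemma fourier_eq_0_mult_polynomial:
  assumes "real_polynomial_function p" "integrable circ h" "\<And>k. fourier h k = 0"
  shows "integrable circ (\<lambda>x. h x * of_real (p (cis x)))" "fourier (\<lambda>x. h x * of_real (p (cis x))) k = 0"
proof -
  have "\<forall>h. integrable circ h \<longrightarrow> (\<forall>k. fourier h k = 0) \<longrightarrow>
          integrable circ (\<lambda>x. h x * of_real (p (cis x))) \<and> (\<forall>k. fourier (\<lambda>x. h x * of_real (p (cis x))) k = 0)"
    using assms(1)
  proof induction
    case (linear L)
    show ?case
    proof (intro allI impI)
      fix h assume h: "integrable circ h" "\<forall>k. fourier h k = 0"
      define \<alpha> \<beta> where "\<alpha> = complex_of_real (L 1) / 2 - \<i> * of_real (L \<i>) / 2"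
        and "\<beta> = complex_of_real (L 1) / 2 + \<i> * of_real (L \<i>) / 2"
      have "complex_of_real (L (cis x)) = \<alpha> * e_mode 1 x + \<beta> * e_mode (- 1) x" for x
      proof -
        have "cis x = cos x *\<^sub>R 1 + sin x *\<^sub>R \<i>"
          by (auto simp: complex_eq_iff)
        then have "L (cis x) = cos x * L 1 + sin x * L \<i>"
          using linear by (simp add: bounded_linear.linear linear_add linear_scale)
        then show ?thesis
          by (simp add: \<alpha>_def \<beta>_def e_mode_cis complex_eq_iff algebra_simps)
      qed
      then have eq: "(\<lambda>x. h x * of_real (L (cis x)))
          = (\<lambda>x. \<alpha> * (h x * e_mode 1 x) + \<beta> * (h x * e_mode (- 1) x))"
        by (intro ext) (simp add: algebra_simps)
      have int: "integrable circ (\<lambda>x. \<alpha> * (h x * e_mode 1 x))" "integrable circ (\<lambda>x. \<beta> * (h x * e_mode (- 1) x))"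
        using h by (auto intro!: integrable_e_mode_mult)
      show "integrable circ (\<lambda>x. h x * of_real (L (cis x))) \<and> (\<forall>k. fourier (\<lambda>x. h x * of_real (L (cis x))) k = 0)"
        unfolding eq using int h(2) by (simp add: fourier_add fourier_scale fourier_e_mode_mult)
    qed
  next
    case (const c)
    then show ?case
      using fourier_scale[of "of_real c"] by (simp add: mult.commute[of _ "complex_of_real c"])
  next
    case (add f g)
    then show ?case by (auto simp: ring_distribs fourier_add)
  next
    case (mult f g)
    then show ?case by (auto simp flip: mult.assoc)
  qed
  with assms show "integrable circ (\<lambda>x. h x * of_real (p (cis x)))" "fourier (\<lambda>x. h x * of_real (p (cis x))) k = 0"
    by auto
qed

text \<open>
  By Stone-Weierstrass on the unit circle of the complex plane.
\<close>

lemma fourier_eq_0_imp_integral_continuous_eq_0: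
  fixes \<phi> :: "complex \<Rightarrow> real"
  assumes h: "integrable circ h" "\<And>k. fourier h k = 0" and \<phi>: "continuous_on UNIV \<phi>"
  shows "(LINT x|circ. h x * of_real (\<phi> (cis x))) = 0"
proof -
  define K where "K = (LINT x|circ. cmod (h x))"
  have K: "K \<ge> 0" unfolding K_def by (rule integral_nonneg_AE) auto
  have "cmod (LINT x|circ. h x * of_real (\<phi> (cis x))) \<le> e * K" if e: "e > 0" for e
  proof -
    obtain p where p: "real_polynomial_function p" "\<And>z. z \<in> sphere 0 1 \<Longrightarrow> \<bar>\<phi> z - p z\<bar> < e"
      using Stone_Weierstrass_real_polynomial_function[OF compact_sphere continuous_on_subset[OF \<phi> subset_UNIV] e, of 0 1]
      by auto
    have cont: "continuous_on UNIV (\<lambda>x. complex_of_real (\<phi> (cis x) - p (cis x)))"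
    proof -
      have cc: "continuous_on UNIV cis" by (rule continuous_on_cis[OF continuous_on_id])
      have "continuous_on UNIV p"
        using continuous_real_polymonial_function[OF p(1)] by (blast intro: continuous_at_imp_continuous_on)
      then have "continuous_on UNIV (\<lambda>x. p (cis x))"
        by (rule continuous_on_compose2[OF _ cc subset_UNIV])
      moreover have "continuous_on UNIV (\<lambda>x. \<phi> (cis x))"
        by (rule continuous_on_compose2[OF \<phi> cc subset_UNIV])
      ultimately show ?thesis by (intro continuous_on_of_real continuous_on_diff)
    qed
    have small: "cmod (complex_of_real (\<phi> (cis x) - p (cis x))) \<le> e" for x
      using p(2)[of "cis x"] by (simp only: norm_of_real) (simp add: less_imp_le)
    have int: "integrable circ (\<lambda>x. h x * complex_of_real (\<phi> (cis x) - p (cis x)))"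
      by (rule integrable_circ_mult_bounded[OF h(1) measurable_lebesgue_continuous[OF cont] small])
    have "(LINT x|circ. h x * of_real (p (cis x))) = 0"
      using fourier_eq_0_mult_polynomial(2)[OF p(1) h, of 0] by (simp add: fourier_circ)
    moreover have "(LINT x|circ. h x * of_real (\<phi> (cis x)))
        = (LINT x|circ. h x * complex_of_real (\<phi> (cis x) - p (cis x)) + h x * of_real (p (cis x)))"
      by (simp add: algebra_simps)
    ultimately have "(LINT x|circ. h x * of_real (\<phi> (cis x))) = (LINT x|circ. h x * complex_of_real (\<phi> (cis x) - p (cis x)))"
      using Bochner_Integration.integral_add[OF int fourier_eq_0_mult_polynomial(1)[OF p(1) h]] by simp
    also have "cmod \<dots> \<le> (LINT x|circ. cmod (h x * complex_of_real (\<phi> (cis x) - p (cis x))))"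
      by (rule integral_norm_bound)
    also have "\<dots> \<le> (LINT x|circ. e * cmod (h x))"
      using int h(1) small
      by (intro integral_mono integrable_norm integrable_mult_right)
         (auto simp: norm_mult mult.commute[of e] intro!: mult_left_mono)
    finally show ?thesis by (simp add: K_def)
  qed
  then have "cmod (LINT x|circ. h x * of_real (\<phi> (cis x))) \<le> 0 + d" if "d > 0" for d
  proof -
    \<comment> \<open>The shift by 1 covers the case that K is 0.\<close>
    have "cmod (LINT x|circ. h x * of_real (\<phi> (cis x))) \<le> (d / (K + 1)) * K"
      using \<open>d > 0\<close> K by (intro \<open>\<And>e. e > 0 \<Longrightarrow> _ e\<close>) simp
    also have "\<dots> \<le> d" using that K by (simp add: field_simps)
    finally show ?thesis by simp
  qed
  then have "cmod (LINT x|circ. h x * of_real (\<phi> (cis x))) \<le> 0" by (rule field_le_epsilon)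
  then show ?thesis by simp
qed

lemma cis_inj_open_interval:
  assumes "t \<in> {0<..<2 * pi}" "x \<in> {0..2 * pi}" "cis x = cis t" shows "x = t"
proof -
  have "cos x = cos t" "sin x = sin t" using assms(3) by (auto simp: complex_eq_iff)
  then obtain n :: int where n: "x = t + 2 * pi * n" using sin_cos_eq_iff[of x t] by auto
  have "2 * pi * (-1) < 2 * pi * real_of_int n" "2 * pi * real_of_int n < 2 * pi * 1"
    using assms(1,2) unfolding n greaterThanLessThan_iff atLeastAtMost_iff by linarith+
  then have "-1 < real_of_int n" "real_of_int n < 1" using pi_gt_zero by (metis mult_left_less_imp_less less_imp_le mult_pos_pos zero_less_numeral)+
  then have "n = 0" by linarith
  with n show ?thesis by simp
qed

text \<open>
  The indicator of \<open>T\<close> is the limit of truncated distance functions to \<open>cis ` T\<close>, which are continuous on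
  the plane. Keeping \<open>T\<close> inside the open interval avoids the identification of the endpoints.
\<close>

lemma fourier_eq_0_imp_integral_compact_eq_0:
  assumes h: "integrable circ h" "\<And>k. fourier h k = 0"
    and T: "compact T" "T \<subseteq> {0<..<2 * pi}" "T \<noteq> {}"
  shows "(LINT x|circ. h x * indicator T x) = 0"
proof -
  let ?C = "cis ` T"
  define \<phi> where "\<phi> n z = max 0 (1 - real n * infdist z ?C)" for n z
  have closed: "closed ?C"
    using T(1) by (intro compact_imp_closed compact_continuous_image continuous_intros continuous_on_cis) auto
  have cont: "continuous_on UNIV (\<phi> n)" for n
    unfolding \<phi>_def by (intro continuous_intros)
  have zero: "(LINT x|circ. h x * of_real (\<phi> n (cis x))) = 0" for n
    by (rule fourier_eq_0_imp_integral_continuous_eq_0[OF h cont])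
  have lim: "(\<lambda>n. \<phi> n (cis x)) \<longlonglongrightarrow> indicator T x" if x: "x \<in> {0..2 * pi}" for x
  proof (cases "x \<in> T")
    case True
    then show ?thesis by (simp add: \<phi>_def)
  next
    case False
    have "cis x \<notin> ?C"
      using False x T(2) cis_inj_open_interval by (metis imageE subsetD)
    then have pos: "infdist (cis x) ?C > 0"
      using closed T(3) infdist_pos_not_in_closed by auto
    obtain N :: nat where N: "1 / infdist (cis x) ?C < real N" using reals_Archimedean2 by blast
    have "\<phi> n (cis x) = 0" if "n \<ge> N" for n
    proof -
      have "1 / infdist (cis x) ?C < real n" using N that by linarith
      then have "1 < real n * infdist (cis x) ?C" using pos by (simp add: field_simps)
      then show ?thesis by (simp add: \<phi>_def)
    qed
    then show ?thesis
      using False by (intro tendsto_eventually) (auto simp: eventually_sequentially)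
  qed
  have "(\<lambda>n. LINT x|circ. h x * of_real (\<phi> n (cis x))) \<longlonglongrightarrow> (LINT x|circ. h x * of_real (indicator T x))"
  proof (rule integral_dominated_convergence[where w = "\<lambda>x. cmod (h x)"])
    show "AE x in circ. (\<lambda>n. h x * of_real (\<phi> n (cis x))) \<longlonglongrightarrow> h x * of_real (indicator T x)"
      using lim by (intro AE_I2 tendsto_mult_left tendsto_of_real) (auto simp: space_restrict_space)
    have "norm (\<phi> n z) \<le> 1" for n z
      using infdist_nonneg[of z ?C] by (auto simp: \<phi>_def)
    then show "AE x in circ. norm (h x * of_real (\<phi> n (cis x))) \<le> cmod (h x)" for n
      by (intro AE_I2) (simp add: norm_mult mult_left_le)
    show "(\<lambda>x. h x * of_real (indicator T x)) \<in> borel_measurable circ"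
    proof (intro borel_measurable_times)
      have "T \<in> sets lebesgue" using T(1) by (simp add: compact_imp_closed)
      then have "(indicator T :: real \<Rightarrow> real) \<in> borel_measurable lebesgue"
        by (rule borel_measurable_indicator)
      then show "(\<lambda>x. complex_of_real (indicator T x)) \<in> borel_measurable circ"
        by (intro measurable_circ borel_measurable_of_real) auto
    qed (use h(1) in auto)
    show "(\<lambda>x. h x * of_real (\<phi> n (cis x))) \<in> borel_measurable circ" for n
    proof (intro borel_measurable_times)
      have "continuous_on UNIV (\<lambda>x. complex_of_real (\<phi> n (cis x)))"
        by (intro continuous_on_of_real continuous_on_compose2[OF cont _ subset_UNIV] continuous_on_cis continuous_on_id)
      then show "(\<lambda>x. complex_of_real (\<phi> n (cis x))) \<in> borel_measurable circ"
        by (intro measurable_circ measurable_lebesgue_continuous)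
    qed (use h(1) in auto)
  qed (use h(1) in auto)
  then have "(LINT x|circ. h x * of_real (indicator T x)) = 0"
    unfolding zero using LIMSEQ_unique tendsto_const by blast
  moreover have "(\<lambda>x. h x * of_real (indicator T x)) = (\<lambda>x. h x * indicator T x)"
    by (auto simp: indicator_def)
  ultimately show ?thesis by simp
qed

text \<open>
  Inner regularity reduces the claim to closed subsets of the set; on such a subset \<open>Re h\<close> is positive
  and has integral \<open>0\<close>, so the subset is null.
\<close>

lemma fourier_eq_0_imp_Re_pos_null:
  assumes h: "integrable circ h" "\<And>k. fourier h k = 0" "h \<in> borel_measurable lebesgue"
  shows "{x \<in> {0<..<2 * pi}. Re (h x) > 0} \<in> null_sets lebesgue"
proof -
  let ?S = "{x \<in> {0<..<2 * pi}. Re (h x) > 0}"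
  have S: "?S \<in> sets lebesgue"
  proof -
    have "{x \<in> space lebesgue. Re (h x) > 0} \<in> sets lebesgue"
      using h(3) by measurable
    then have "{0<..<2 * pi} \<inter> {x. Re (h x) > 0} \<in> sets lebesgue" by (intro sets.Int) auto
    then show ?thesis by (simp add: Int_def)
  qed
  have null: "emeasure lebesgue T = 0" if T: "closed T" "T \<subseteq> ?S" for T
  proof (cases "T = {}")
    case False
    have "compact T"
    proof -
      have "T \<subseteq> {0..2 * pi}" using T(2) by force
      then have "bounded T" by (rule bounded_subset[OF compact_imp_bounded[OF compact_Icc]])
      then show ?thesis using T(1) by (simp add: compact_eq_bounded_closed)
    qed
    moreover have sub: "T \<subseteq> {0<..<2 * pi}" using T by auto
    ultimately have zero: "(LINT x|circ. h x * indicator T x) = 0"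
      by (intro fourier_eq_0_imp_integral_compact_eq_0 h False)
    have Tm: "T \<in> sets lebesgue" using T by simp
    have int: "integrable circ (\<lambda>x. h x * indicator T x)"
      using Tm by (intro integrable_circ_mult_bounded[OF h(1), of _ 1]) (auto simp: indicator_def)
    then have "(LINT x|circ. Re (h x * indicator T x)) = 0"
      using zero by (simp only: integral_Re[OF int]) simp
    moreover have "AE x in circ. 0 \<le> Re (h x * indicator T x)"
      using T by (intro AE_I2) (auto simp: indicator_def)
    ultimately have "AE x in circ. Re (h x * indicator T x) = 0"
      using integral_nonneg_eq_0_iff_AE[OF integrable_Re[OF int]] by blast
    then have "AE x in lebesgue. x \<in> {0..2 * pi} \<longrightarrow> Re (h x * indicator T x) = 0"
      by (simp add: AE_restrict_space_iff)
    then have "AE x in lebesgue. x \<notin> T"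
    proof eventually_elim
      case (elim x)
      show ?case
      proof
        assume "x \<in> T"
        moreover from this T(2) have "x \<in> {0..2 * pi}" "Re (h x) > 0" by force+
        ultimately show False using elim by simp
      qed
    qed
    then show ?thesis
      using AE_iff_measurable[of T lebesgue "\<lambda>x. x \<notin> T"] Tm by auto
  qed simp
  have "emeasure lebesgue ?S \<le> ennreal e" if e: "e > 0" for e
  proof -
    obtain T where T: "closed T" "T \<subseteq> ?S" "?S - T \<in> lmeasurable" "emeasure lebesgue (?S - T) < ennreal e"
      using sets_lebesgue_inner_closed[OF S e] .
    have "T \<union> (?S - T) = ?S" using T(2) by blast
    moreover have "emeasure lebesgue (T \<union> (?S - T)) \<le> emeasure lebesgue T + emeasure lebesgue (?S - T)"
      by (rule emeasure_subadditive) (simp add: T(1), rule fmeasurableD[OF T(3)])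
    ultimately have "emeasure lebesgue ?S \<le> 0 + emeasure lebesgue (?S - T)"
      by (simp only: null[OF T(1,2)])
    also have "\<dots> \<le> ennreal e" using T(4) by (simp add: less_imp_le)
    finally show ?thesis .
  qed
  then have le: "emeasure lebesgue ?S \<le> 0 + ennreal e" if "e > 0" for e
    unfolding add_0 using that .
  have "emeasure lebesgue ?S \<le> 0" by (rule ennreal_le_epsilon) (rule le)
  then have "emeasure lebesgue ?S = 0" by (simp only: le_zero_eq)
  then show ?thesis using S by (rule null_setsI)
qed

text \<open>
  The preceding lemma, applied to \<open>h\<close>, \<open>-h\<close>, \<open>ih\<close> and \<open>-ih\<close>.
\<close>

lemma fourier_eq_0_imp_AE_eq_0:
  assumes h: "integrable circ h" "\<And>k. fourier h k = 0" "h \<in> borel_measurable lebesgue"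
  shows "AE x in circ. h x = 0"
proof -
  have *: "{x \<in> {0<..<2 * pi}. Re (c * h x) > 0} \<in> null_sets lebesgue" for c
    using h by (intro fourier_eq_0_imp_Re_pos_null) (auto simp: fourier_scale)
  let ?N = "{0, 2 * pi} \<union> {x \<in> {0<..<2 * pi}. Re (1 * h x) > 0} \<union> {x \<in> {0<..<2 * pi}. Re ((-1) * h x) > 0}
    \<union> {x \<in> {0<..<2 * pi}. Re (\<i> * h x) > 0} \<union> {x \<in> {0<..<2 * pi}. Re ((-\<i>) * h x) > 0}"
  have "?N \<in> null_sets lebesgue"
    by (intro null_sets.Un *) (auto intro: finite_imp_null_set_lborel null_sets_completionI)
  then have "AE x in lebesgue. x \<notin> ?N" by (rule AE_not_in)
  then have "AE x in lebesgue. x \<in> {0..2 * pi} \<longrightarrow> h x = 0"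
    by eventually_elim (auto simp: complex_eq_iff not_less intro: order_antisym)
  then show ?thesis by (simp add: AE_restrict_space_iff)
qed

section \<open>The cubic nonlinearity and its mean values\<close>

definition trig_poly :: "int set \<Rightarrow> fseries \<Rightarrow> real \<Rightarrow> complex" where
  "trig_poly B a x = (\<Sum>k\<in>B. a k * e_mode k x)"

lemma measurable_trig: "trig_poly B a \<in> borel_measurable lebesgue"
  unfolding trig_poly_def[abs_def] by measurable

lemma norm_trig_le: "cmod (trig_poly B a x) \<le> (\<Sum>k\<in>B. cmod (a k))"
  unfolding trig_poly_def by (rule sum_norm_le) (simp add: norm_mult)

lemma integrable_trig_sum: "integrable circ (\<lambda>x. \<Sum>i\<in>I. c i * e_mode (n i) x)"
  by (intro Bochner_Integration.integrable_sum integrable_mult_right)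
     (auto intro: integrable_circ_bounded[where C = 1])

lemma fourier_trig:
  assumes "finite B" shows "fourier (trig_poly B a) k = (if k \<in> B then a k else 0)"
proof -
  have "fourier (trig_poly B a) k = (\<Sum>j\<in>{j\<in>B. j = k}. a j)"
    unfolding trig_poly_def[abs_def] by (rule fourier_trig_sum[OF assms])
  also have "{j\<in>B. j = k} = (if k \<in> B then {k} else {})" by auto
  finally show ?thesis by simp
qed

lemma fourier_cubic_trig:
  assumes "finite B"
  shows "fourier (\<lambda>x. of_real ((cmod (trig_poly B a x))\<^sup>2) * trig_poly B a x) k = tri B a a a k"
proof -
  have "of_real ((cmod (trig_poly B a x))\<^sup>2) * trig_poly B a x
      = (\<Sum>i\<in>B \<times> B \<times> B. (case i of (p, q, r) \<Rightarrow> a p * a q * cnj (a r)) * e_mode (case i of (p, q, r) \<Rightarrow> p + q - r) x)" for x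
  proof -
    have "of_real ((cmod (trig_poly B a x))\<^sup>2) * trig_poly B a x = trig_poly B a x * (trig_poly B a x * cnj (trig_poly B a x))"
      by (simp only: complex_norm_square mult_ac)
    also have "\<dots> = (\<Sum>p\<in>B. \<Sum>q\<in>B. \<Sum>r\<in>B. (a p * e_mode p x) * ((a q * e_mode q x) * cnj (a r * e_mode r x)))"
      unfolding trig_poly_def cnj_sum sum_product by (simp only: sum_distrib_left sum_product)
    also have "\<dots> = (\<Sum>i\<in>B \<times> B \<times> B. (case i of (p, q, r) \<Rightarrow> a p * a q * cnj (a r)) * e_mode (case i of (p, q, r) \<Rightarrow> p + q - r) x)"
      unfolding sum.cartesian_product
      by (intro sum.cong refl) (auto simp: cnj_e_mode e_mode_add diff_conv_add_uminus simp del: add_uminus_conv_diff)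
    finally show ?thesis .
  qed
  then have "fourier (\<lambda>x. of_real ((cmod (trig_poly B a x))\<^sup>2) * trig_poly B a x) k
      = (\<Sum>i\<in>{i\<in>B \<times> B \<times> B. (case i of (p, q, r) \<Rightarrow> p + q - r) = k}. case i of (p, q, r) \<Rightarrow> a p * a q * cnj (a r))"
    using assms by (simp add: fourier_trig_sum)
  also have "{i\<in>B \<times> B \<times> B. (case i of (p, q, r) \<Rightarrow> p + q - r) = k} = res3 B k"
    by (auto simp: res3_def)
  finally show ?thesis by (simp add: tri_def)
qed

lemma L2_circle_integrable:
  assumes "f \<in> L2_circle" shows "integrable circ f" "f \<in> borel_measurable lebesgue"
proof -
  show m: "f \<in> borel_measurable lebesgue" using assms by (simp add: L2_circle_def)
  have int: "integrable circ (\<lambda>x. (cmod (f x))\<^sup>2)"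
    using assms by (simp add: L2_circle_def set_integrable_iff_integrable_circ)
  show "integrable circ f"
  proof (rule Bochner_Integration.integrable_bound)
    show "integrable circ (\<lambda>x. 1 + (cmod (f x))\<^sup>2)"
      using int by (intro Bochner_Integration.integrable_add finite_measure.integrable_const[OF finite_measure_circ])
    have "y \<le> 1 + y\<^sup>2" for y :: real
      using zero_le_power2[of "y - 1/2"] by (simp add: power2_eq_square algebra_simps)
    then show "AE x in circ. norm (f x) \<le> norm (1 + (cmod (f x))\<^sup>2)"
      by (intro AE_I2) (simp add: add_nonneg_nonneg)
  qed (use m in \<open>rule measurable_circ\<close>)
qed

lemma sobolev_plusD:
  assumes "f \<in> sobolev_plus s"
  shows "integrable circ f" "f \<in> borel_measurable lebesgue" "fourier f \<in> Hspace s"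
    "\<And>k. k < 0 \<Longrightarrow> fourier f k = 0"
  using assms L2_circle_integrable[of f] by (auto simp: sobolev_plus_def L2_plus_def szego_def)

text \<open>
  For \<open>s \<ge> 1\<close> the coefficients are absolutely summable, so their Fourier series converges uniformly to a
  bounded function \<open>g\<close> with the same coefficients as \<open>f\<close>. By uniqueness \<open>f = g\<close> almost everywhere, and
  the cubic terms of the partial sums converge boundedly to that of \<open>g\<close>.
\<close>

lemma fourier_cubic_sobolev:
  assumes s: "s \<ge> 1" and f: "f \<in> sobolev_plus s"
  shows "(\<lambda>J. tri (modes J) (fourier f) (fourier f) (fourier f) k)
           \<longlonglongrightarrow> fourier (\<lambda>x. of_real ((cmod (f x))\<^sup>2) * f x) k"
proof -
  define a where "a = fourier f"
  note f = sobolev_plusD[OF f, folded a_def]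
  define C where "C = sqrt Sinv * Hnorm s a"
  have sumC: "(\<Sum>k\<in>modes J. cmod (a k)) \<le> C" for J
  proof -
    have "(\<Sum>k\<in>modes J. cmod (a k)) \<le> sqrt Sinv * pnorm s (modes J) a"
      by (rule sum_cmod_le_pnorm[OF s]) (auto simp: modes_def)
    also have "\<dots> \<le> C"
      unfolding C_def using Sinv_ge_1 by (intro mult_left_mono pnorm_le_Hnorm f) auto
    finally show ?thesis .
  qed
  have C: "cmod (trig_poly (modes J) a x) \<le> C" for J x
    using norm_trig_le[of "modes J" a x] sumC[of J] by linarith
  have summ: "summable (\<lambda>n. a (int n) * e_mode (int n) x)" for x
  proof (rule summable_norm_cancel, rule summableI_nonneg_bounded)
    fix n
    have "(\<Sum>i<n. norm (a (int i) * e_mode (int i) x)) \<le> (\<Sum>i\<le>n. cmod (a (int i)))"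
      by (simp add: norm_mult) (intro sum_mono2, auto)
    also have "\<dots> \<le> C" using sumC[of n] by (simp add: sum_modes)
    finally show "(\<Sum>i<n. norm (a (int i) * e_mode (int i) x)) \<le> C" .
  qed simp
  define g where "g x = (\<Sum>n. a (int n) * e_mode (int n) x)" for x
  have lim: "(\<lambda>J. trig_poly (modes J) a x) \<longlonglongrightarrow> g x" for x
    unfolding g_def trig_poly_def sum_modes by (rule summable_LIMSEQ'[OF summ])
  have g_meas: "g \<in> borel_measurable lebesgue"
    by (rule borel_measurable_LIMSEQ_metric[OF measurable_trig lim])
  have gC: "cmod (g x) \<le> C" for x
    using C by (intro LIMSEQ_le_const2[OF tendsto_norm[OF lim[of x]]]) auto
  have g_int: "integrable circ g" by (rule integrable_circ_bounded[OF g_meas gC])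
  have "fourier g k = a k" for k
  proof (rule LIMSEQ_unique)
    show "(\<lambda>J. fourier (trig_poly (modes J) a) k) \<longlonglongrightarrow> fourier g k"
      by (rule fourier_dominated_convergence[OF measurable_trig g_meas C lim])
    have "\<forall>\<^sub>F J in sequentially. fourier (trig_poly (modes J) a) k = a k"
      using eventually_ge_at_top[of "nat k"]
      by eventually_elim (use f(4) in \<open>auto simp: fourier_trig modes_def not_le\<close>)
    then show "(\<lambda>J. fourier (trig_poly (modes J) a) k) \<longlonglongrightarrow> a k" by (rule tendsto_eventually)
  qed
  then have zero: "fourier (\<lambda>x. f x - g x) k = 0" for k
    using fourier_diff[OF f(1) g_int, of k] by (simp add: a_def)
  have "AE x in circ. f x - g x = 0"
    by (rule fourier_eq_0_imp_AE_eq_0[OF _ zero]) (use f(1,2) g_int g_meas in auto)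
  then have ae: "AE x in circ. of_real ((cmod (f x))\<^sup>2) * f x * e_mode (- k) x = of_real ((cmod (g x))\<^sup>2) * g x * e_mode (- k) x"
    by eventually_elim simp
  have "fourier (\<lambda>x. of_real ((cmod (f x))\<^sup>2) * f x) k = fourier (\<lambda>x. of_real ((cmod (g x))\<^sup>2) * g x) k"
    unfolding fourier_circ
    using f(2) g_meas
    by (intro arg_cong2[where f="(*)"] refl integral_cong_AE ae measurable_circ) auto
  moreover have "(\<lambda>J. fourier (\<lambda>x. of_real ((cmod (trig_poly (modes J) a x))\<^sup>2) * trig_poly (modes J) a x) k)
       \<longlonglongrightarrow> fourier (\<lambda>x. of_real ((cmod (g x))\<^sup>2) * g x) k"
  proof (rule fourier_dominated_convergence[where C = "C\<^sup>2 * C"])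
    show "cmod (of_real ((cmod (trig_poly (modes J) a x))\<^sup>2) * trig_poly (modes J) a x) \<le> C\<^sup>2 * C" for J x
      using C[of J x] by (auto simp: norm_mult norm_power intro!: mult_mono power_mono)
    show "(\<lambda>J. of_real ((cmod (trig_poly (modes J) a x))\<^sup>2) * trig_poly (modes J) a x)
        \<longlonglongrightarrow> of_real ((cmod (g x))\<^sup>2) * g x" for x
      by (intro tendsto_intros lim)
    show "(\<lambda>x. of_real ((cmod (trig_poly (modes J) a x))\<^sup>2) * trig_poly (modes J) a x) \<in> borel_measurable lebesgue" for J
      using measurable_trig[of "modes J" a] by measurable
    show "(\<lambda>x. of_real ((cmod (g x))\<^sup>2) * g x) \<in> borel_measurable lebesgue"
      using g_meas by measurable
  qed
  ultimately show ?thesis by (simp only: fourier_cubic_trig finite_modes a_def)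
qed

text \<open>
  Expanding the square. Of its two uses, \<open>c\<close> equal to the mass expresses a variance and bounds the
  quartic form from below, while \<open>c = 1\<close> bounds it from above when the modulus is close to \<open>1\<close>.
\<close>

lemma mean_square_deviation:
  fixes c :: real
  assumes B: "finite B"
  shows "(LINT x|circ. ((cmod (trig_poly B a x))\<^sup>2 - c)\<^sup>2) / (2 * pi)
       = Re (quart B a a a a) - 2 * c * (\<Sum>k\<in>B. (cmod (a k))\<^sup>2) + c\<^sup>2"
proof -
  let ?I4 = "B \<times> B \<times> B \<times> B" and ?I2 = "B \<times> B"
  let ?c4 = "\<lambda>(p, q, r, l). a p * a q * cnj (a r) * cnj (a l)" and ?n4 = "\<lambda>(p, q, r, l). p + q - r - (l :: int)"
  let ?c2 = "\<lambda>(p, q). a p * cnj (a q)" and ?n2 = "\<lambda>(p, q). p - (q :: int)"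
  let ?f4 = "\<lambda>x. \<Sum>i\<in>?I4. ?c4 i * e_mode (?n4 i) x" and ?f2 = "\<lambda>x. \<Sum>i\<in>?I2. ?c2 i * e_mode (?n2 i) x"
  let ?g = "trig_poly B a"
  have sq: "of_real ((cmod (?g x))\<^sup>2) = ?f2 x" for x
  proof -
    have "of_real ((cmod (?g x))\<^sup>2) = (\<Sum>p\<in>B. \<Sum>q\<in>B. (a p * e_mode p x) * cnj (a q * e_mode q x))"
      unfolding complex_norm_square trig_poly_def cnj_sum sum_product ..
    also have "\<dots> = ?f2 x"
      unfolding sum.cartesian_product
      by (intro sum.cong refl) (auto simp: cnj_e_mode e_mode_add diff_conv_add_uminus simp del: add_uminus_conv_diff)
    finally show ?thesis .
  qed
  have fourth: "of_real ((cmod (?g x))\<^sup>2) * of_real ((cmod (?g x))\<^sup>2) = ?f4 x" for x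
  proof -
    have "of_real ((cmod (?g x))\<^sup>2) * of_real ((cmod (?g x))\<^sup>2) = ?g x * (?g x * (cnj (?g x) * cnj (?g x)))"
      by (simp only: complex_norm_square mult_ac)
    also have "\<dots> = (\<Sum>p\<in>B. \<Sum>q\<in>B. \<Sum>r\<in>B. \<Sum>l\<in>B. (a p * e_mode p x) * ((a q * e_mode q x) * (cnj (a r * e_mode r x) * cnj (a l * e_mode l x))))"
      unfolding trig_poly_def cnj_sum sum_product by (simp only: sum_distrib_left sum_product)
    also have "\<dots> = ?f4 x"
      unfolding sum.cartesian_product
      by (intro sum.cong refl) (auto simp: cnj_e_mode e_mode_add diff_conv_add_uminus simp del: add_uminus_conv_diff)
    finally show ?thesis .
  qed
  have i4: "integrable circ ?f4" and i2: "integrable circ ?f2" by (rule integrable_trig_sum)+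
  have ic: "integrable circ (\<lambda>x. of_real (c\<^sup>2) :: complex)"
    by (rule finite_measure.integrable_const[OF finite_measure_circ])
  have expand: "complex_of_real (((cmod (?g x))\<^sup>2 - c)\<^sup>2) = (?f4 x - of_real (2 * c) * ?f2 x) + of_real (c\<^sup>2)" for x
    unfolding fourth[symmetric] sq[symmetric] of_real_mult[symmetric] of_real_add[symmetric] of_real_diff[symmetric]
    by (rule arg_cong[where f = of_real]) (simp add: power2_eq_square algebra_simps)
  have "complex_of_real ((LINT x|circ. ((cmod (?g x))\<^sup>2 - c)\<^sup>2) / (2 * pi))
      = fourier (\<lambda>x. complex_of_real (((cmod (?g x))\<^sup>2 - c)\<^sup>2)) 0"
    unfolding fourier_circ by (simp del: of_real_power of_real_diff)
  also have "\<dots> = fourier ?f4 0 - of_real (2 * c) * fourier ?f2 0 + of_real (c\<^sup>2) * fourier (e_mode 0) 0"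
    unfolding expand using i4 i2 ic fourier_scale[of "of_real (c\<^sup>2)" "e_mode 0" 0]
    by (subst fourier_add; (subst fourier_diff)?) (simp_all add: fourier_scale del: of_real_mult)
  also have "fourier ?f4 0 = quart B a a a a"
  proof -
    have "fourier ?f4 0 = sum ?c4 {i \<in> ?I4. ?n4 i = 0}" using B by (intro fourier_trig_sum) auto
    also have "{i \<in> ?I4. ?n4 i = 0} = res4 B" by (auto simp: res4_def)
    finally show ?thesis by (simp add: quart_def)
  qed
  also have "fourier ?f2 0 = of_real (\<Sum>k\<in>B. (cmod (a k))\<^sup>2)"
  proof -
    have "fourier ?f2 0 = sum ?c2 {i \<in> ?I2. ?n2 i = 0}" using B by (intro fourier_trig_sum) auto
    also have "{i \<in> ?I2. ?n2 i = 0} = (\<lambda>k. (k, k)) ` B" by auto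
    also have "sum ?c2 \<dots> = of_real (\<Sum>k\<in>B. (cmod (a k))\<^sup>2)"
      by (subst sum.reindex) (auto simp: inj_on_def complex_norm_square[symmetric])
    finally show ?thesis .
  qed
  finally have "Re (complex_of_real ((LINT x|circ. ((cmod (?g x))\<^sup>2 - c)\<^sup>2) / (2 * pi)))
      = Re (quart B a a a a - of_real (2 * c) * of_real (\<Sum>k\<in>B. (cmod (a k))\<^sup>2) + of_real (c\<^sup>2) * fourier (e_mode 0) 0)"
    by (rule arg_cong[where f = Re])
  then show ?thesis
    unfolding fourier_e_mode of_real_mult[symmetric] by (simp only: Re_complex_of_real minus_complex.simps plus_complex.simps refl if_True mult_1_right)
qed

lemma mass_square_le_quart:
  assumes "finite B" shows "(\<Sum>k\<in>B. (cmod (a k))\<^sup>2)\<^sup>2 \<le> Re (quart B a a a a)"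
proof -
  let ?M = "\<Sum>k\<in>B. (cmod (a k))\<^sup>2"
  have "0 \<le> (LINT x|circ. ((cmod (trig_poly B a x))\<^sup>2 - ?M)\<^sup>2) / (2 * pi)"
    by (intro divide_nonneg_nonneg integral_nonneg_AE) auto
  then show ?thesis
    unfolding mean_square_deviation[OF assms] by (simp add: power2_eq_square)
qed

lemma quart_le_mass_square:
  assumes B: "finite B" and le: "\<And>x. \<bar>(cmod (trig_poly B a x))\<^sup>2 - 1\<bar> \<le> d"
  shows "Re (quart B a a a a) \<le> (\<Sum>k\<in>B. (cmod (a k))\<^sup>2)\<^sup>2 + d\<^sup>2"
proof -
  let ?M = "\<Sum>k\<in>B. (cmod (a k))\<^sup>2"
  have le2: "((cmod (trig_poly B a x))\<^sup>2 - 1)\<^sup>2 \<le> d\<^sup>2" for x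
    using le[of x] by (metis abs_ge_zero power2_abs power_mono)
  have "(LINT x|circ. ((cmod (trig_poly B a x))\<^sup>2 - 1)\<^sup>2) \<le> (LINT x|circ. d\<^sup>2)"
  proof (rule integral_mono)
    show "integrable circ (\<lambda>x. ((cmod (trig_poly B a x))\<^sup>2 - 1)\<^sup>2)"
    proof (rule integrable_circ_bounded[where C = "d\<^sup>2"])
      show "(\<lambda>x. ((cmod (trig_poly B a x))\<^sup>2 - 1)\<^sup>2) \<in> borel_measurable lebesgue"
        using measurable_trig[of B a] by measurable
    qed (use le2 in simp)
    show "integrable circ (\<lambda>x. d\<^sup>2)" by (rule finite_measure.integrable_const[OF finite_measure_circ])
  qed (use le2 in simp)
  also have "\<dots> = 2 * pi * d\<^sup>2" by (simp add: measure_restrict_space)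
  finally have "(LINT x|circ. ((cmod (trig_poly B a x))\<^sup>2 - 1)\<^sup>2) / (2 * pi) \<le> d\<^sup>2"
    by (simp add: divide_le_eq mult.commute)
  then have "Re (quart B a a a a) - 2 * ?M + 1 \<le> d\<^sup>2"
    unfolding mean_square_deviation[OF B] by simp
  moreover have "0 \<le> (?M - 1)\<^sup>2" by simp
  ultimately show ?thesis by (simp add: power2_eq_square algebra_simps)
qed

section \<open>Limits of almost conserved quantities and continuity arguments\<close>

text \<open>
  A pointwise limit of the derivatives is enough, since the Henstock-Kurzweil integral obeys dominated
  convergence and integrates every derivative.
\<close>

lemma difference_tendsto_0_interval:
  fixes f f' :: "nat \<Rightarrow> real \<Rightarrow> real"
  assumes le: "a \<le> b"
    and deriv: "\<And>J \<tau>. (f J has_real_derivative f' J \<tau>) (at \<tau>)"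
    and bound: "\<And>J \<tau>. a \<le> \<tau> \<Longrightarrow> \<tau> \<le> b \<Longrightarrow> \<bar>f' J \<tau>\<bar> \<le> C"
    and lim: "\<And>\<tau>. (\<lambda>J. f' J \<tau>) \<longlonglongrightarrow> 0"
  shows "(\<lambda>J. f J b - f J a) \<longlonglongrightarrow> 0"
proof -
  have int: "(f' J has_integral f J b - f J a) {a..b}" for J
    using le deriv[of J]
    by (intro fundamental_theorem_of_calculus)
       (auto simp: has_real_derivative_iff_has_vector_derivative intro: has_vector_derivative_at_within)
  have "(\<lambda>J. integral {a..b} (f' J)) \<longlonglongrightarrow> integral {a..b} (\<lambda>_. 0)"
  proof (rule dominated_convergence)
    show "f' J integrable_on {a..b}" for J using int by (rule has_integral_integrable)
    show "(\<lambda>_. C) integrable_on {a..b}" by (rule integrable_const_ivl)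
    show "norm (f' J \<tau>) \<le> C" if "\<tau> \<in> {a..b}" for J \<tau> using bound that by simp
    show "(\<lambda>J. f' J \<tau>) \<longlonglongrightarrow> 0" for \<tau> by (rule lim)
  qed
  then show ?thesis using integral_unique[OF int] by simp
qed

lemma difference_tendsto_0:
  fixes f f' :: "nat \<Rightarrow> real \<Rightarrow> real"
  assumes deriv: "\<And>J \<tau>. (f J has_real_derivative f' J \<tau>) (at \<tau>)"
    and bound: "\<And>J \<tau>. \<bar>\<tau>\<bar> \<le> \<bar>t\<bar> \<Longrightarrow> \<bar>f' J \<tau>\<bar> \<le> C"
    and lim: "\<And>\<tau>. (\<lambda>J. f' J \<tau>) \<longlonglongrightarrow> 0"
  shows "(\<lambda>J. f J t - f J 0) \<longlonglongrightarrow> 0"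
proof (cases "t \<ge> 0")
  case True
  then show ?thesis by (rule difference_tendsto_0_interval[OF _ deriv bound lim]) (use True in auto)
next
  case False
  have "(\<lambda>J. f J 0 - f J t) \<longlonglongrightarrow> 0"
    by (rule difference_tendsto_0_interval[OF _ deriv bound lim]) (use False in auto)
  from tendsto_minus[OF this] show ?thesis by simp
qed

text \<open>
  The first time (in modulus, on the side of \<open>t\<close>) at which \<open>W\<close> reaches \<open>c\<close> contradicts the improved bound.
  The condition \<open>\<tau> * t \<ge> 0\<close> says that \<open>\<tau>\<close> lies on the same side of \<open>0\<close> as \<open>t\<close>.
\<close>

lemma continuous_bootstrap:
  fixes W :: "real \<Rightarrow> real"
  assumes cont: "\<And>t. isCont W t" and init: "W 0 < c"
    and improve: "\<And>t. \<bar>t\<bar> \<le> T \<Longrightarrow> (\<And>\<tau>. \<bar>\<tau>\<bar> \<le> \<bar>t\<bar> \<Longrightarrow> \<tau> * t \<ge> 0 \<Longrightarrow> W \<tau> \<le> c) \<Longrightarrow> W t < c"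
    and t: "\<bar>t\<bar> \<le> T"
  shows "W t < c"
proof (rule ccontr)
  assume "\<not> W t < c"
  define f where "f x = W (x * t)" for x
  have contf: "continuous_on S f" for S
    unfolding f_def by (intro continuous_at_imp_continuous_on ballI isCont_o2[OF _ cont]) simp
  define A where "A = {x \<in> {0..1}. c \<le> f x}"
  have "1 \<in> A" using \<open>\<not> W t < c\<close> by (simp add: A_def f_def)
  moreover have "closed A"
    unfolding A_def by (intro continuous_on_closed_Collect_le contf continuous_intros)
  moreover have "bounded A" unfolding A_def by (rule bounded_subset[of "{0..1}"]) auto
  ultimately obtain x where x: "x \<in> A" "\<And>y. y \<in> A \<Longrightarrow> x \<le> y"
    using compact_attains_inf[of A] by (auto simp: compact_eq_bounded_closed)
  have x01: "0 \<le> x" "x \<le> 1" "c \<le> f x" using x(1) by (auto simp: A_def)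
  have below: "f y < c" if "0 \<le> y" "y < x" for y
  proof -
    have "y \<notin> A" using x(2)[of y] that by force
    then show ?thesis using that x01 by (auto simp: A_def)
  qed
  have "f x \<le> c"
  proof (rule ccontr)
    assume "\<not> f x \<le> c"
    moreover have "f 0 < c" using init by (simp add: f_def)
    ultimately obtain y where y: "0 \<le> y" "y \<le> x" "f y = c"
      using IVT'[of f 0 c x] x01 contf by auto
    with below[of y] \<open>\<not> f x \<le> c\<close> show False by (cases "y = x") auto
  qed
  have "W (x * t) < c"
  proof (rule improve)
    show "\<bar>x * t\<bar> \<le> T"
      using x01 t mult_right_mono[of x 1 "\<bar>t\<bar>"] by (simp add: abs_mult)
    fix \<tau> assume \<tau>: "\<bar>\<tau>\<bar> \<le> \<bar>x * t\<bar>" "\<tau> * (x * t) \<ge> 0"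
    show "W \<tau> \<le> c"
    proof (cases "x * t = 0")
      case True
      then have "\<tau> = 0" using \<tau>(1) by (simp only: abs_zero abs_le_zero_iff)
      then show ?thesis using init by simp
    next
      case False
      then have nz: "x > 0" "t \<noteq> 0" using x01 by auto
      define y where "y = \<tau> / t"
      have "\<tau> = y * t" using nz by (simp add: y_def)
      moreover have "0 \<le> y"
      proof -
        have "x * 0 \<le> x * (\<tau> * t)" using \<tau>(2) by (simp add: mult_ac)
        then have "0 \<le> \<tau> * t" using nz by (simp only: mult_le_cancel_left_pos)
        then show ?thesis using nz unfolding y_def by (simp add: zero_le_divide_iff zero_le_mult_iff)
      qed
      moreover have "y \<le> x"
        using \<tau>(1) nz \<open>0 \<le> y\<close> unfolding \<open>\<tau> = y * t\<close> by (simp add: abs_mult)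
      ultimately show ?thesis using below[of y] \<open>f x \<le> c\<close> by (cases "y = x") (auto simp: f_def)
    qed
  qed
  with x01 show False by (simp add: f_def)
qed

section \<open>Mass and energy conservation for the flow\<close>

lemma Hnorm_minus_commute: "Hnorm s (\<lambda>k. a k - b k) = Hnorm s (\<lambda>k. b k - a k)"
  unfolding Hnorm_def by (simp add: norm_minus_commute)

lemma abs_Hnorm_diff_le:
  assumes "a \<in> Hspace s" "b \<in> Hspace s"
  shows "\<bar>Hnorm s a - Hnorm s b\<bar> \<le> Hnorm s (\<lambda>k. a k - b k)"
  using Hspace_add(2)[OF Hspace_diff[OF assms] assms(2)] Hspace_add(2)[OF Hspace_diff[OF assms(2,1)] assms(1)]
    Hnorm_minus_commute[of s a b] by simp

definition head :: "int set \<Rightarrow> fseries \<Rightarrow> fseries" where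
  "head S a = (\<lambda>k. if k \<in> S then a k else 0)"

lemma tri_head:
  assumes "finite B" "S \<subseteq> B"
  shows "tri B (head S a) (head S b) (head S c) k = tri S a b c k"
  unfolding tri_def
proof (rule sum.mono_neutral_cong_right[OF finite_res3[OF assms(1)]])
qed (use assms(2) in \<open>auto simp: res3_def head_def split: if_splits\<close>)

lemma head_plus_without: "a = (\<lambda>k. head S a k + without S a k)"
  by (auto simp: head_def without_def)

lemma head_le: "cmod (head S a k) \<le> cmod (a k)"
  by (simp add: head_def)

lemma modes_mono: "J \<le> J' \<Longrightarrow> modes J \<subseteq> modes J'"
  by (auto simp: modes_def)

lemma modes_nonneg: "modes J \<subseteq> {0..}"
  by (auto simp: modes_def)

lemma eventually_subset_modes:
  assumes "finite F" "F \<subseteq> {0..}"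
  shows "\<forall>\<^sub>F J in sequentially. F \<subseteq> modes J"
proof -
  have "\<forall>\<^sub>F J in sequentially. \<forall>k\<in>F. k \<in> modes J"
  proof (rule eventually_ball_finite[OF assms(1)], rule ballI)
    fix k assume "k \<in> F"
    then have "k \<ge> 0" using assms(2) by auto
    then have "k \<in> modes J" if "J \<ge> nat k" for J using that by (simp add: modes_def)
    then show "\<forall>\<^sub>F J in sequentially. k \<in> modes J"
      unfolding eventually_sequentially by blast
  qed
  then show ?thesis by (simp add: subset_eq)
qed

lemma tendsto_pnorm:
  assumes "\<And>k. k \<in> L \<Longrightarrow> (\<lambda>J. f J k) \<longlonglongrightarrow> g k"
  shows "(\<lambda>J. pnorm s L (f J)) \<longlonglongrightarrow> pnorm s L g"
  unfolding pnorm_def L2_set_def by (intro tendsto_intros assms)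

text \<open>
  Truncating the input and truncating the form are the same thing by \<open>tri_head\<close>, so the difference
  telescopes into three terms that each contain one tail.
\<close>

lemma tri_diff_head_le:
  assumes s: "s \<ge> 1" and a: "a \<in> Hspace s" and L: "finite L" "L \<subseteq> {0..}" and J: "J \<le> J'"
  shows "pnorm s L (\<lambda>k. tri (modes J') a a a k - tri (modes J) a a a k)
     \<le> 3 * tri_const s * (Hnorm s a)\<^sup>2 * Hnorm s (without (modes J) a)"
proof -
  let ?B = "modes J'" and ?h = "head (modes J) a" and ?w = "without (modes J) a"
  let ?n = "Hnorm s a" and ?d = "Hnorm s (without (modes J) a)"
  have "tri ?B a a a k - tri (modes J) a a a k
      = (tri ?B ?w a a k + tri ?B ?h ?w a k) + tri ?B ?h ?h ?w k" for k
  proof -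
    have "tri ?B a a a k = tri ?B ?h a a k + tri ?B ?w a a k"
      using tri_add1[of ?B ?h ?w a a k] head_plus_without[of a "modes J"] by simp
    moreover have "tri ?B ?h a a k = tri ?B ?h ?h a k + tri ?B ?h ?w a k"
      using tri_add2[of ?B ?h ?h ?w a k] head_plus_without[of a "modes J"] by simp
    moreover have "tri ?B ?h ?h a k = tri ?B ?h ?h ?h k + tri ?B ?h ?h ?w k"
      using tri_add3[of ?B ?h ?h ?h ?w k] head_plus_without[of a "modes J"] by simp
    ultimately show ?thesis
      using tri_head[of ?B "modes J" a a a k] modes_mono[OF J] by simp
  qed
  then have "pnorm s L (\<lambda>k. tri ?B a a a k - tri (modes J) a a a k)
      \<le> pnorm s L (tri ?B ?w a a) + pnorm s L (tri ?B ?h ?w a) + pnorm s L (tri ?B ?h ?h ?w)"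
    using pnorm_triangle[of s L "\<lambda>k. tri ?B ?w a a k + tri ?B ?h ?w a k" "tri ?B ?h ?h ?w"]
      pnorm_triangle[of s L "tri ?B ?w a a" "tri ?B ?h ?w a"] by simp
  moreover have bnd: "pnorm s L (tri ?B x y z) \<le> tri_const s * (X * Y * Z)"
    if "pnorm s ?B x \<le> X" "pnorm s ?B y \<le> Y" "pnorm s ?B z \<le> Z" for x y z X Y Z
  proof -
    have "pnorm s L (tri ?B x y z) \<le> tri_const s * (pnorm s ?B x * pnorm s ?B y * pnorm s ?B z)"
      by (intro pnorm_tri_le s L finite_modes modes_nonneg)
    also have "\<dots> \<le> tri_const s * (X * Y * Z)"
      using that less_imp_le[OF tri_const_pos] order_trans[OF pnorm_nonneg that(1)] order_trans[OF pnorm_nonneg that(2)]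
      by (intro mult_left_mono mult_mono) auto
    finally show ?thesis .
  qed
  have pa: "pnorm s ?B a \<le> ?n" by (intro pnorm_le_Hnorm a) simp
  have ph: "pnorm s ?B ?h \<le> ?n"
    using pnorm_mono[of ?B ?h a s] pa head_le by force
  have pw: "pnorm s ?B ?w \<le> ?d" by (intro pnorm_le_Hnorm without_Hspace a) simp
  note bnd[OF pw pa pa] bnd[OF ph pw pa] bnd[OF ph ph pw]
  ultimately show ?thesis by (simp add: power2_eq_square algebra_simps)
qed

text \<open>
  A solution seen through its Fourier coefficients, with the nonlinearity \<open>N\<close> given as the limit of its
  truncations to boxes.
\<close>

locale coefficient_flow =
  fixes s \<nu> :: real and a N :: "real \<Rightarrow> fseries"
  assumes s: "s \<ge> 1" and \<nu>_pos: "0 < \<nu>" and \<nu>_le_1: "\<nu> \<le> 1"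
    and supp: "\<And>t k. k < 0 \<Longrightarrow> a t k = 0"
    and Hspace: "\<And>t. a t \<in> Hspace s"
    and continuous: "\<And>t. ((\<lambda>\<tau>. Hnorm s (\<lambda>k. a \<tau> k - a t k)) \<longlongrightarrow> 0) (at t)"
    and deriv: "\<And>t k. 0 \<le> k \<Longrightarrow> ((\<lambda>\<tau>. a \<tau> k) has_vector_derivative
                  - \<i> * (of_real (\<nu> * (of_int k)\<^sup>2) * a t k + N t k)) (at t)"
    and cubic: "\<And>t k. 0 \<le> k \<Longrightarrow> (\<lambda>J. tri (modes J) (a t) (a t) (a t) k) \<longlonglongrightarrow> N t k"
begin

lemma isCont_Hnorm_without: "isCont (\<lambda>\<tau>. Hnorm s (without S (a \<tau>))) t"
proof -
  have le: "\<bar>Hnorm s (without S (a \<tau>)) - Hnorm s (without S (a t))\<bar> \<le> Hnorm s (\<lambda>k. a \<tau> k - a t k)" for \<tau>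
  proof -
    have "\<bar>Hnorm s (without S (a \<tau>)) - Hnorm s (without S (a t))\<bar>
        \<le> Hnorm s (\<lambda>k. without S (a \<tau>) k - without S (a t) k)"
      by (intro abs_Hnorm_diff_le without_Hspace Hspace)
    also have "\<dots> \<le> Hnorm s (\<lambda>k. a \<tau> k - a t k)"
      by (rule Hspace_mono(2)[OF Hspace_diff[OF Hspace Hspace]]) (simp add: without_def)
    finally show ?thesis .
  qed
  have "((\<lambda>\<tau>. Hnorm s (without S (a \<tau>)) - Hnorm s (without S (a t))) \<longlongrightarrow> 0) (at t)"
    by (rule Lim_null_comparison[OF always_eventually continuous]) (use le in simp)
  then show ?thesis unfolding isCont_def by (simp add: LIM_zero_iff)
qed

lemma locally_bounded: "\<exists>C \<ge> 0. \<forall>\<tau>. \<bar>\<tau>\<bar> \<le> T \<longrightarrow> Hnorm s (a \<tau>) \<le> C"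
proof -
  have "continuous_on {-T..T} (\<lambda>\<tau>. Hnorm s (a \<tau>))"
    using isCont_Hnorm_without[where S = "{}"] by (auto simp: without_def intro: continuous_at_imp_continuous_on)
  then have "bounded ((\<lambda>\<tau>. Hnorm s (a \<tau>)) ` {-T..T})"
    by (intro compact_imp_bounded compact_continuous_image) auto
  then obtain C where "\<forall>y \<in> (\<lambda>\<tau>. Hnorm s (a \<tau>)) ` {-T..T}. norm y \<le> C"
    unfolding bounded_iff by blast
  then have C: "norm (Hnorm s (a \<tau>)) \<le> C" if "\<tau> \<in> {-T..T}" for \<tau>
    using that by blast
  show ?thesis
  proof (intro exI[of _ "max 0 C"] conjI allI impI)
    fix \<tau> assume "\<bar>\<tau>\<bar> \<le> T"
    then show "Hnorm s (a \<tau>) \<le> max 0 C" using C[of \<tau>] by (auto simp: abs_le_iff)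
  qed simp
qed

text \<open>
  The error made in the modes up to \<open>J\<close> when all other modes are dropped from the nonlinearity.
\<close>

definition R :: "nat \<Rightarrow> real \<Rightarrow> fseries" where
  "R J t k = N t k - tri (modes J) (a t) (a t) (a t) k"

lemma pnorm_R_le:
  assumes L: "finite L" "L \<subseteq> {0..}"
  shows "pnorm s L (R J t) \<le> 3 * tri_const s * (Hnorm s (a t))\<^sup>2 * Hnorm s (without (modes J) (a t))"
proof (rule LIMSEQ_le_const2)
  show "(\<lambda>J'. pnorm s L (\<lambda>k. tri (modes J') (a t) (a t) (a t) k - tri (modes J) (a t) (a t) (a t) k))
      \<longlonglongrightarrow> pnorm s L (R J t)"
    unfolding R_def using L by (intro tendsto_pnorm tendsto_intros cubic) auto
  show "\<exists>J0. \<forall>J'\<ge>J0. pnorm s L (\<lambda>k. tri (modes J') (a t) (a t) (a t) k - tri (modes J) (a t) (a t) (a t) k)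
      \<le> 3 * tri_const s * (Hnorm s (a t))\<^sup>2 * Hnorm s (without (modes J) (a t))"
    using tri_diff_head_le[OF s Hspace L] by blast
qed

lemma pnorm_R_tendsto_0: "(\<lambda>J. pnorm s (modes J) (R J t)) \<longlonglongrightarrow> 0"
proof (rule tendsto_sandwich[OF always_eventually always_eventually tendsto_const])
  show "\<forall>J. pnorm s (modes J) (R J t) \<le> 3 * tri_const s * (Hnorm s (a t))\<^sup>2 * Hnorm s (without (modes J) (a t))"
    by (intro allI pnorm_R_le finite_modes modes_nonneg)
  show "(\<lambda>J. 3 * tri_const s * (Hnorm s (a t))\<^sup>2 * Hnorm s (without (modes J) (a t))) \<longlonglongrightarrow> 0"
    by (intro tendsto_mult_right_zero Hnorm_tail_tendsto_0 Hspace supp)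
qed simp

lemma pnorm_R_bound:
  assumes "Hnorm s (a t) \<le> C"
  shows "pnorm s (modes J) (R J t) \<le> 3 * tri_const s * C ^ 3"
proof -
  have "pnorm s (modes J) (R J t) \<le> 3 * tri_const s * (Hnorm s (a t))\<^sup>2 * Hnorm s (without (modes J) (a t))"
    by (intro pnorm_R_le finite_modes modes_nonneg)
  also have "\<dots> \<le> 3 * tri_const s * C\<^sup>2 * C"
    using assms without_Hspace(2)[OF Hspace[of t], of "modes J"] less_imp_le[OF tri_const_pos[of s]]
      order_trans[OF Hnorm_nonneg assms]
    by (intro mult_mono mult_left_mono power_mono) auto
  finally show ?thesis by (simp add: power3_eq_cube power2_eq_square)
qed

definition mass :: "nat \<Rightarrow> real \<Rightarrow> real" where
  "mass J t = (\<Sum>k\<in>modes J. (cmod (a t k))\<^sup>2)"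

definition spread :: "int \<Rightarrow> nat \<Rightarrow> real \<Rightarrow> real" where
  "spread m J t = (\<Sum>k\<in>modes J. (of_int (k - m))\<^sup>2 * (cmod (a t k))\<^sup>2)"

definition energy :: "int \<Rightarrow> nat \<Rightarrow> real \<Rightarrow> real" where
  "energy m J t = \<nu> * spread m J t + Re (quart (modes J) (a t) (a t) (a t) (a t)) / 2"

lemma truncated_equation:
  assumes "k \<in> modes J"
  shows "((\<lambda>\<tau>. a \<tau> k) has_vector_derivative
           - \<i> * (of_real (\<nu> * (of_int k)\<^sup>2) * a t k + tri (modes J) (a t) (a t) (a t) k + R J t k)) (at t)"
  using deriv[of k t] assms by (simp add: R_def modes_def)

lemma mass_derivative:
  "(mass J has_real_derivative 2 * (\<Sum>k\<in>modes J. Im (cnj (a t k) * R J t k))) (at t)"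
  unfolding mass_def by (rule truncated_conservation_laws(1)[OF finite_modes truncated_equation refl])

lemma energy_derivative:
  "(energy m J has_real_derivative
     2 * \<nu> * (\<Sum>k\<in>modes J. (of_int (k - m))\<^sup>2 * Im (cnj (a t k) * R J t k))
     + 2 * (\<Sum>k\<in>modes J. Im (cnj (tri (modes J) (a t) (a t) (a t) k) * R J t k))) (at t)"
  unfolding energy_def spread_def
  by (rule truncated_conservation_laws(2)[OF finite_modes truncated_equation refl])

lemma one_le_bracket_square: "1 \<le> (bracket s k)\<^sup>2"
  using one_plus_square_le_bracket[OF s, of k] zero_le_power2[of "real_of_int k"] by linarith

text \<open>
  Cauchy-Schwarz for \<open>k - m = k * 1 + 1 * (-m)\<close>.
\<close>

lemma shift_square_le: "(of_int (k - m))\<^sup>2 \<le> (1 + (of_int m)\<^sup>2) * (bracket s k)\<^sup>2"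
proof -
  have "0 \<le> (of_int k * of_int m + 1 :: real)\<^sup>2" by simp
  then have "(of_int (k - m))\<^sup>2 \<le> (1 + (of_int m)\<^sup>2) * (1 + (real_of_int k)\<^sup>2)"
    by (simp add: power2_eq_square algebra_simps)
  also have "\<dots> \<le> (1 + (of_int m)\<^sup>2) * (bracket s k)\<^sup>2"
    by (intro mult_left_mono one_plus_square_le_bracket s) simp
  finally show ?thesis .
qed

lemma mass_derivative_le:
  assumes C: "Hnorm s (a t) \<le> C"
  shows "\<bar>2 * (\<Sum>k\<in>modes J. Im (cnj (a t k) * R J t k))\<bar> \<le> 2 * C * pnorm s (modes J) (R J t)"
proof -
  have "\<bar>\<Sum>k\<in>modes J. 1 * Im (cnj (a t k) * R J t k)\<bar> \<le> 1 * (pnorm s (modes J) (a t) * pnorm s (modes J) (R J t))"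
    by (rule abs_weighted_Im_pairing_le) (use one_le_bracket_square in auto)
  also have "\<dots> \<le> C * pnorm s (modes J) (R J t)"
    using pnorm_le_Hnorm[OF Hspace[of t] finite_modes[of J]] C by (auto intro: mult_right_mono)
  finally show ?thesis by (simp add: abs_mult)
qed

lemma energy_derivative_le:
  assumes C: "Hnorm s (a t) \<le> C"
  shows "\<bar>2 * \<nu> * (\<Sum>k\<in>modes J. (of_int (k - m))\<^sup>2 * Im (cnj (a t k) * R J t k))
     + 2 * (\<Sum>k\<in>modes J. Im (cnj (tri (modes J) (a t) (a t) (a t) k) * R J t k))\<bar>
    \<le> (2 * (1 + (of_int m)\<^sup>2) * C + 2 * tri_const s * C ^ 3) * pnorm s (modes J) (R J t)"
proof -
  let ?R = "pnorm s (modes J) (R J t)" and ?T = "tri (modes J) (a t) (a t) (a t)"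
  have a: "pnorm s (modes J) (a t) \<le> C"
    using pnorm_le_Hnorm[OF Hspace[of t] finite_modes[of J]] C by linarith
  have C0: "0 \<le> C" using order_trans[OF Hnorm_nonneg C] .
  have "\<bar>\<Sum>k\<in>modes J. (of_int (k - m))\<^sup>2 * Im (cnj (a t k) * R J t k)\<bar>
      \<le> (1 + (of_int m)\<^sup>2) * (pnorm s (modes J) (a t) * ?R)"
    by (rule abs_weighted_Im_pairing_le) (use shift_square_le in auto)
  also have "\<dots> \<le> (1 + (of_int m)\<^sup>2) * (C * ?R)"
    using a by (intro mult_left_mono mult_right_mono) auto
  finally have 1: "\<bar>\<nu> * (\<Sum>k\<in>modes J. (of_int (k - m))\<^sup>2 * Im (cnj (a t k) * R J t k))\<bar> \<le> (1 + (of_int m)\<^sup>2) * (C * ?R)"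
    using \<nu>_pos \<nu>_le_1 unfolding abs_mult
    by (intro order_trans[OF mult_left_le_one_le]) auto
  have "pnorm s (modes J) ?T \<le> tri_const s * (pnorm s (modes J) (a t) * pnorm s (modes J) (a t) * pnorm s (modes J) (a t))"
    by (intro pnorm_tri_le s finite_modes modes_nonneg)
  also have "\<dots> \<le> tri_const s * (C * C * C)"
    using a C0 less_imp_le[OF tri_const_pos] by (intro mult_left_mono mult_mono) auto
  finally have T: "pnorm s (modes J) ?T \<le> tri_const s * C ^ 3" by (simp add: power3_eq_cube)
  have "\<bar>\<Sum>k\<in>modes J. 1 * Im (cnj (?T k) * R J t k)\<bar> \<le> 1 * (pnorm s (modes J) ?T * ?R)"
    by (rule abs_weighted_Im_pairing_le) (use one_le_bracket_square in auto)
  also have "\<dots> \<le> tri_const s * C ^ 3 * ?R"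
    using T by (auto intro: mult_right_mono)
  finally have 2: "\<bar>\<Sum>k\<in>modes J. Im (cnj (?T k) * R J t k)\<bar> \<le> tri_const s * C ^ 3 * ?R" by simp
  have "\<bar>2 * \<nu> * X + 2 * Y\<bar> \<le> 2 * P + 2 * Q" if "\<bar>\<nu> * X\<bar> \<le> P" "\<bar>Y\<bar> \<le> Q" for X Y P Q
    using that by (simp add: abs_le_iff algebra_simps)
  note this[OF 1 2]
  also have "2 * ((1 + (of_int m)\<^sup>2) * (C * ?R)) + 2 * (tri_const s * C ^ 3 * ?R)
      = (2 * (1 + (of_int m)\<^sup>2) * C + 2 * tri_const s * C ^ 3) * ?R"
    by (simp only: ring_distribs mult.assoc)
  finally show ?thesis .
qed

text \<open>
  The remainder tends to \<open>0\<close> at each time and is bounded uniformly in \<open>J\<close> on compact time intervals,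
  which is what dominated convergence needs.
\<close>

lemma truncated_law_conserved:
  fixes f f' :: "nat \<Rightarrow> real \<Rightarrow> real"
  assumes deriv: "\<And>J \<tau>. (f J has_real_derivative f' J \<tau>) (at \<tau>)"
    and le: "\<And>J \<tau> C. Hnorm s (a \<tau>) \<le> C \<Longrightarrow> \<bar>f' J \<tau>\<bar> \<le> K C * pnorm s (modes J) (R J \<tau>)"
    and K: "\<And>C. C \<ge> 0 \<Longrightarrow> K C \<ge> 0"
  shows "(\<lambda>J. f J t - f J 0) \<longlonglongrightarrow> 0"
proof -
  obtain C where C: "C \<ge> 0" "\<And>\<tau>. \<bar>\<tau>\<bar> \<le> \<bar>t\<bar> \<Longrightarrow> Hnorm s (a \<tau>) \<le> C"
    using locally_bounded[of "\<bar>t\<bar>"] by auto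
  show ?thesis
  proof (rule difference_tendsto_0[OF deriv])
    fix J \<tau> assume "\<bar>\<tau>\<bar> \<le> \<bar>t\<bar>"
    from le[OF C(2)[OF this], of J] pnorm_R_bound[OF C(2)[OF this], of J] K[OF C(1)]
    show "\<bar>f' J \<tau>\<bar> \<le> K C * (3 * tri_const s * C ^ 3)"
      by (meson mult_left_mono order_trans)
  next
    fix \<tau>
    have lim: "(\<lambda>J. K (Hnorm s (a \<tau>)) * pnorm s (modes J) (R J \<tau>)) \<longlonglongrightarrow> 0"
      by (intro tendsto_mult_right_zero pnorm_R_tendsto_0)
    show "(\<lambda>J. f' J \<tau>) \<longlonglongrightarrow> 0"
      by (rule Lim_null_comparison[OF always_eventually lim]) (use le in simp)
  qed
qed

lemma mass_conserved: "(\<lambda>J. mass J t - mass J 0) \<longlonglongrightarrow> 0"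
  by (rule truncated_law_conserved[OF mass_derivative mass_derivative_le]) auto

lemma energy_conserved: "(\<lambda>J. energy m J t - energy m J 0) \<longlonglongrightarrow> 0"
  by (rule truncated_law_conserved[OF energy_derivative energy_derivative_le])
     (auto intro!: add_nonneg_nonneg mult_nonneg_nonneg less_imp_le[OF tri_const_pos])

end

section \<open>Constants of the stability estimate\<close>

definition unit_mode :: "int \<Rightarrow> fseries" where
  "unit_mode m = (\<lambda>k. if k = m then 1 else 0)"

lemma pnorm_single:
  assumes "finite F" shows "pnorm s F (\<lambda>k. if k = m then c else 0) \<le> bracket s m * cmod c"
proof (rule power2_le_imp_le)
  have "(pnorm s F (\<lambda>k. if k = m then c else 0))\<^sup>2 = (\<Sum>k\<in>F. if k = m then (bracket s m * cmod c)\<^sup>2 else 0)"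
    unfolding pnorm_square by (intro sum.cong) (auto simp: power_mult_distrib)
  also have "\<dots> \<le> (bracket s m * cmod c)\<^sup>2" using assms by simp
  finally show "(pnorm s F (\<lambda>k. if k = m then c else 0))\<^sup>2 \<le> (bracket s m * cmod c)\<^sup>2" .
qed simp

lemma unit_mode_Hspace: "unit_mode m \<in> Hspace s"
  using Hnorm_leI(1)[of s "unit_mode m" "bracket s m * cmod 1"] pnorm_single[of _ s m 1]
  by (simp add: unit_mode_def)

lemma trig_unit_mode: "finite B \<Longrightarrow> m \<in> B \<Longrightarrow> trig_poly B (unit_mode m) x = e_mode m x"
  by (simp add: trig_poly_def unit_mode_def if_distrib[of "\<lambda>z. z * _"] cong: if_cong)

lemma one_le_shift_square:
  assumes "k \<noteq> m" shows "1 \<le> (real_of_int (k - m))\<^sup>2"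
proof -
  have "1 \<le> \<bar>real_of_int (k - m)\<bar>" using assms by linarith
  from power_mono[OF this, of 2] show ?thesis by simp
qed

text \<open>
  The constant in \<open>D(t) \<le> C \<delta>\<^sup>2\<close>: the first two terms bound the initial spread, the last one the initial
  variance of \<open>|u|\<^sup>2\<close>.
\<close>

definition spread_const :: "int \<Rightarrow> real" where
  "spread_const m = 1 + (of_int m)\<^sup>2 + Sinv * (2 + sqrt Sinv)\<^sup>2"

lemma spread_const_ge_1: "spread_const m \<ge> 1"
  using Sinv_ge_1 by (simp add: spread_const_def)

text \<open>
  The constant \<open>\<kappa>\<close> of the bootstrap assumption \<open>|w| \<le> \<kappa> \<delta>\<close>. Of the \<open>3\<close> under the root, one unit accounts for the high
  modes initially, one for their growth, and one is left as the gain that makes the conclusion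
  strict.
\<close>

definition bootstrap_const :: "real \<Rightarrow> int \<Rightarrow> real" where
  "bootstrap_const s m = sqrt ((1 + 4 * (of_int m)\<^sup>2) powr s * spread_const m + 3)"

text \<open>
  Under the bootstrap assumption the energy of the high modes grows at most at the rate
  \<open>growth_const s m * \<delta>\<^sup>3\<close>; the \<open>6\<close> is \<open>3\<close> quadratic interactions times the bound \<open>2\<close> for \<open>|a m|\<close>.
\<close>

definition growth_const :: "real \<Rightarrow> int \<Rightarrow> real" where
  "growth_const s m = 2 * tri_const s * (6 * bracket s m * bootstrap_const s m ^ 3 + bootstrap_const s m ^ 4)"

lemma bootstrap_const_square: "(bootstrap_const s m)\<^sup>2 = (1 + 4 * (of_int m)\<^sup>2) powr s * spread_const m + 3"
proof -
  have "0 \<le> (1 + 4 * (of_int m)\<^sup>2) powr s * spread_const m"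
    using spread_const_ge_1[of m] by (intro mult_nonneg_nonneg) auto
  then show ?thesis unfolding bootstrap_const_def by (intro real_sqrt_pow2) linarith
qed

lemma bootstrap_const_gt_1: "bootstrap_const s m > 1"
proof -
  have "0 \<le> (1 + 4 * (of_int m)\<^sup>2) powr s * spread_const m"
    using spread_const_ge_1[of m] by (intro mult_nonneg_nonneg) auto
  then show ?thesis unfolding bootstrap_const_def by (intro real_less_rsqrt) simp
qed

lemma growth_const_pos: "growth_const s m > 0"
proof -
  have "bootstrap_const s m > 0" using bootstrap_const_gt_1[of s m] by linarith
  then show ?thesis
    unfolding growth_const_def by (intro mult_pos_pos add_pos_pos zero_less_power tri_const_pos bracket_pos) auto
qed

section \<open>Energy estimate for the modes above twice the reference frequency\<close>

context coefficient_flow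
begin

text \<open>
  Of the terms with at least two factors \<open>e\<close>, those with \<open>p = q = m\<close> would need \<open>r = 2m - k < 0\<close>, a frequency
  that does not occur; the other two are trivial resonances and give a real multiple of \<open>w k\<close>.
\<close>

lemma high_mode_tri:
  fixes A :: complex
  assumes A: "A = a t m" and m: "m \<in> modes J" and k: "k \<in> modes J" "2 * m < k"
  defines "e \<equiv> (\<lambda>k. if k = m then A else 0)" and "w \<equiv> without {m} (a t)"
  shows "tri (modes J) (a t) (a t) (a t) k
     = (tri (modes J) e w w k + tri (modes J) w e w k + tri (modes J) w w e k + tri (modes J) w w w k)
       + of_real (2 * (cmod A)\<^sup>2) * w k"
proof -
  let ?t = "tri (modes J)"
  \<comment> \<open>The part of the solution in the mode m, plus the rest.\<close>
  have split: "a t = (\<lambda>k. e k + w k)"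
    by (auto simp: e_def w_def without_def A)
  have "k \<noteq> m" using k m by (auto simp: modes_def)
  have eew: "?t e e c k = 0" for c
    unfolding tri_def
  proof (rule sum.neutral, clarify)
    fix p q r assume "(p, q, r) \<in> res3 (modes J) k"
    then have "p \<noteq> m \<or> q \<noteq> m" using k(2) by (auto simp: res3_def modes_def)
    then show "e p * e q * cnj (c r) = 0" by (auto simp: e_def)
  qed
  have "?t e w e k = (\<Sum>(p, q, r) \<in> {(m, k, m)}. e p * w q * cnj (e r))"
    unfolding tri_def
    by (rule sum.mono_neutral_right[OF finite_res3[OF finite_modes]])
       (use m k in \<open>auto simp: res3_def e_def split: if_splits\<close>)
  then have ewe: "?t e w e k = of_real ((cmod A)\<^sup>2) * w k"
    by (simp only: complex_norm_square) (simp add: e_def)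
  have "?t w e e k = (\<Sum>(p, q, r) \<in> {(k, m, m)}. w p * e q * cnj (e r))"
    unfolding tri_def
    by (rule sum.mono_neutral_right[OF finite_res3[OF finite_modes]])
       (use m k in \<open>auto simp: res3_def e_def split: if_splits\<close>)
  then have wee: "?t w e e k = of_real ((cmod A)\<^sup>2) * w k"
    by (simp only: complex_norm_square) (simp add: e_def)
  have "?t (a t) (a t) (a t) k = ?t e e e k + ?t e e w k + ?t e w e k + ?t e w w k + ?t w e e k + ?t w e w k + ?t w w e k + ?t w w w k"
    unfolding split tri_add1 tri_add2 tri_add3 by (simp add: add_ac)
  then show ?thesis unfolding eew ewe wee by (simp add: algebra_simps)
qed

text \<open>
  The real multiple of \<open>w k\<close> drops out of the imaginary part, so that only interactions of second and
  third order in \<open>w\<close> remain.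
\<close>

lemma high_mode_pairing_le:
  assumes m: "0 \<le> m" and F: "finite F" "F \<subseteq> {2 * m<..}"
  shows "\<bar>\<Sum>k\<in>F. (bracket s k)\<^sup>2 * Im (cnj (a t k) * N t k)\<bar>
     \<le> tri_const s * (3 * (bracket s m * cmod (a t m)) * Hnorm s (without {m} (a t)) ^ 3
                       + Hnorm s (without {m} (a t)) ^ 4)"
proof (rule LIMSEQ_le_const2)
  let ?w = "without {m} (a t)" and ?e = "\<lambda>k. if k = m then a t m else 0"
  let ?W = "Hnorm s (without {m} (a t))" and ?A = "bracket s m * cmod (a t m)"
  have F0: "F \<subseteq> {0..}" using F m by force
  show "(\<lambda>J. \<bar>\<Sum>k\<in>F. (bracket s k)\<^sup>2 * Im (cnj (a t k) * tri (modes J) (a t) (a t) (a t) k)\<bar>)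
      \<longlonglongrightarrow> \<bar>\<Sum>k\<in>F. (bracket s k)\<^sup>2 * Im (cnj (a t k) * N t k)\<bar>"
    using F0 by (intro tendsto_intros cubic) auto
  have "\<bar>\<Sum>k\<in>F. (bracket s k)\<^sup>2 * Im (cnj (a t k) * tri (modes J) (a t) (a t) (a t) k)\<bar>
      \<le> tri_const s * (3 * ?A * ?W ^ 3 + ?W ^ 4)" if J: "insert m F \<subseteq> modes J" for J
  proof -
    let ?t = "tri (modes J)"
    define Q where "Q k = (?t ?e ?w ?w k + ?t ?w ?e ?w k + ?t ?w ?w ?e k) + ?t ?w ?w ?w k" for k
    have "Im (cnj (a t k) * ?t (a t) (a t) (a t) k) = Im (cnj (?w k) * Q k)" if k: "k \<in> F" for k
    proof -
      have wk: "?w k = a t k" using k F m by (auto simp: without_def)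
      have "?t (a t) (a t) (a t) k = Q k + of_real (2 * (cmod (a t m))\<^sup>2) * ?w k"
        unfolding Q_def using high_mode_tri[OF refl, of m J k t] k F J by auto
      then show ?thesis unfolding wk[symmetric] by (simp add: algebra_simps)
    qed
    then have "\<bar>\<Sum>k\<in>F. (bracket s k)\<^sup>2 * Im (cnj (a t k) * ?t (a t) (a t) (a t) k)\<bar>
        = \<bar>\<Sum>k\<in>F. (bracket s k)\<^sup>2 * Im (cnj (?w k) * Q k)\<bar>" by simp
    also have "\<dots> \<le> 1 * (pnorm s F ?w * pnorm s F Q)"
      by (rule abs_weighted_Im_pairing_le) auto
    also have "\<dots> \<le> ?W * (tri_const s * (3 * ?A * ?W\<^sup>2 + ?W ^ 3))"
    proof -
      have w: "pnorm s B ?w \<le> ?W" if "finite B" for B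
        by (intro pnorm_le_Hnorm without_Hspace Hspace that)
      have e: "pnorm s (modes J) ?e \<le> ?A" by (rule pnorm_single) simp
      have bnd: "pnorm s F (?t x y z) \<le> tri_const s * (X * Y * Z)"
        if "pnorm s (modes J) x \<le> X" "pnorm s (modes J) y \<le> Y" "pnorm s (modes J) z \<le> Z" for x y z X Y Z
      proof -
        have "pnorm s F (?t x y z) \<le> tri_const s * (pnorm s (modes J) x * pnorm s (modes J) y * pnorm s (modes J) z)"
          by (intro pnorm_tri_le s F F0 finite_modes modes_nonneg)
        also have "\<dots> \<le> tri_const s * (X * Y * Z)"
          using that less_imp_le[OF tri_const_pos] order_trans[OF pnorm_nonneg that(1)] order_trans[OF pnorm_nonneg that(2)]
          by (intro mult_left_mono mult_mono) auto
        finally show ?thesis .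
      qed
      note w' = w[OF finite_modes]
      have "pnorm s F Q \<le> pnorm s F (?t ?e ?w ?w) + pnorm s F (?t ?w ?e ?w) + pnorm s F (?t ?w ?w ?e) + pnorm s F (?t ?w ?w ?w)"
        unfolding Q_def
        by (intro order_trans[OF pnorm_triangle] add_mono order_refl)
      with bnd[OF e w' w'] bnd[OF w' e w'] bnd[OF w' w' e] bnd[OF w' w' w']
      have "pnorm s F Q \<le> tri_const s * (3 * ?A * ?W\<^sup>2 + ?W ^ 3)"
        by (simp add: power2_eq_square power3_eq_cube algebra_simps)
      then show ?thesis using w[OF F(1)] unfolding mult_1 by (intro mult_mono) auto
    qed
    also have "\<dots> = tri_const s * (3 * ?A * ?W ^ 3 + ?W ^ 4)"
      by (simp add: power2_eq_square power3_eq_cube power4_eq_xxxx algebra_simps)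
    finally show ?thesis .
  qed
  moreover have "\<forall>\<^sub>F J in sequentially. insert m F \<subseteq> modes J"
    using F F0 m by (intro eventually_subset_modes) auto
  ultimately show "\<exists>J0. \<forall>J\<ge>J0. \<bar>\<Sum>k\<in>F. (bracket s k)\<^sup>2 * Im (cnj (a t k) * tri (modes J) (a t) (a t) (a t) k)\<bar>
      \<le> tri_const s * (3 * ?A * ?W ^ 3 + ?W ^ 4)"
    unfolding eventually_sequentially by blast
qed

lemma high_mode_derivative:
  assumes "F \<subseteq> {0..}"
  shows "((\<lambda>\<tau>. \<Sum>k\<in>F. (bracket s k)\<^sup>2 * (cmod (a \<tau> k))\<^sup>2) has_real_derivative
           2 * (\<Sum>k\<in>F. (bracket s k)\<^sup>2 * Im (cnj (a t k) * N t k))) (at t)"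
proof -
  let ?a' = "\<lambda>k. - \<i> * (of_real (\<nu> * (of_int k)\<^sup>2) * a t k + N t k)"
  have "((\<lambda>\<tau>. \<Sum>k\<in>F. (bracket s k)\<^sup>2 * (cmod (a \<tau> k))\<^sup>2) has_real_derivative
           (\<Sum>k\<in>F. (bracket s k)\<^sup>2 * (2 * Re (cnj (a t k) * ?a' k)))) (at t)"
    using assms by (intro has_real_derivative_weighted_mass deriv) auto
  also have "(\<Sum>k\<in>F. (bracket s k)\<^sup>2 * (2 * Re (cnj (a t k) * ?a' k)))
      = 2 * (\<Sum>k\<in>F. (bracket s k)\<^sup>2 * Im (cnj (a t k) * N t k))"
    unfolding sum_distrib_left by (intro sum.cong refl) (simp add: algebra_simps)
  finally show ?thesis .
qed

end

section \<open>Orbital stability of a single mode\<close>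

text \<open>
  For \<open>\<nu> = \<epsilon>\<^sup>\<alpha>\<close> the last three assumptions hold with \<open>\<delta> = \<epsilon>\<close> to the power \<open>1 - \<alpha>/2\<close>.
\<close>

locale perturbed_mode = coefficient_flow +
  fixes m :: int and \<epsilon> \<delta> :: real
  assumes m: "0 \<le> m" and \<epsilon>: "0 < \<epsilon>" "\<epsilon> < 1"
    and init: "Hnorm s (\<lambda>k. a 0 k - unit_mode m k) = \<epsilon>"
    and \<epsilon>_le_\<delta>: "\<epsilon> \<le> \<delta>" and \<delta>_le_1: "\<delta> \<le> 1" and \<delta>_square: "\<epsilon>\<^sup>2 = \<nu> * \<delta>\<^sup>2"
begin

definition h :: fseries where "h k = a 0 k - unit_mode m k"

lemma \<delta>_pos: "0 < \<delta>" using \<epsilon> \<epsilon>_le_\<delta> by linarith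

lemma h_Hspace: "h \<in> Hspace s"
  unfolding h_def by (intro Hspace_diff Hspace unit_mode_Hspace)

lemma Hnorm_h: "Hnorm s h = \<epsilon>" using init by (simp add: h_def[abs_def])

lemma pnorm_h: "finite F \<Longrightarrow> pnorm s F h \<le> \<epsilon>"
  using pnorm_le_Hnorm[OF h_Hspace] Hnorm_h by simp

lemma initial_away: "k \<noteq> m \<Longrightarrow> a 0 k = h k"
  by (simp add: h_def unit_mode_def)

lemma initial_mass_le: "mass J 0 \<le> (1 + \<epsilon>)\<^sup>2"
proof -
  have "L2_set (\<lambda>k. cmod (a 0 k)) (modes J) \<le> L2_set (\<lambda>k. cmod (unit_mode m k) + cmod (h k)) (modes J)"
    by (intro L2_set_mono) (auto simp: h_def intro: order_trans[OF _ norm_triangle_ineq])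
  also have "\<dots> \<le> L2_set (\<lambda>k. cmod (unit_mode m k)) (modes J) + L2_set (\<lambda>k. cmod (h k)) (modes J)"
    by (rule L2_set_triangle_ineq)
  also have "L2_set (\<lambda>k. cmod (unit_mode m k)) (modes J) \<le> 1"
  proof -
    have "(\<Sum>k\<in>modes J. (cmod (unit_mode m k))\<^sup>2) = (\<Sum>k\<in>modes J. if k = m then 1 else 0)"
      by (intro sum.cong) (auto simp: unit_mode_def)
    also have "\<dots> \<le> (1 :: real)" by simp
    finally show ?thesis by (simp add: L2_set_def)
  qed
  also have "L2_set (\<lambda>k. cmod (h k)) (modes J) \<le> pnorm s (modes J) h"
    unfolding pnorm_def
  proof (rule L2_set_mono)
    fix k
    have "1 \<le> bracket s k"
      using one_le_bracket_square[of k] bracket_nonneg[of s k] by (simp add: power2_nonneg_ge_1_iff)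
    then show "cmod (h k) \<le> bracket s k * cmod (h k)" by (simp add: mult_le_cancel_right1)
  qed simp
  also have "pnorm s (modes J) h \<le> \<epsilon>" by (rule pnorm_h) simp
  finally have "L2_set (\<lambda>k. cmod (a 0 k)) (modes J) \<le> 1 + \<epsilon>" by simp
  from power_mono[OF this, of 2] show ?thesis
    by (simp add: L2_set_nonneg mass_def) (simp add: L2_set_def sum_nonneg)
qed

lemma initial_spread_le: "spread m J 0 \<le> (1 + (of_int m)\<^sup>2) * \<epsilon>\<^sup>2"
proof -
  have "spread m J 0 \<le> (\<Sum>k\<in>modes J. (1 + (of_int m)\<^sup>2) * ((bracket s k)\<^sup>2 * (cmod (h k))\<^sup>2))"
    unfolding spread_def
  proof (rule sum_mono)
    fix k
    show "(of_int (k - m))\<^sup>2 * (cmod (a 0 k))\<^sup>2 \<le> (1 + (of_int m)\<^sup>2) * ((bracket s k)\<^sup>2 * (cmod (h k))\<^sup>2)"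
    proof (cases "k = m")
      case False
      then show ?thesis
        using mult_right_mono[OF shift_square_le[of k m], of "(cmod (h k))\<^sup>2"] by (simp add: initial_away mult.assoc)
    qed simp
  qed
  also have "\<dots> = (1 + (of_int m)\<^sup>2) * (pnorm s (modes J) h)\<^sup>2"
    by (simp add: pnorm_square sum_distrib_left)
  also have "\<dots> \<le> (1 + (of_int m)\<^sup>2) * \<epsilon>\<^sup>2"
    by (intro mult_left_mono power_mono pnorm_h) auto
  finally show ?thesis .
qed

text \<open>
  Initially \<open>|u|\<close> differs from \<open>1\<close> by at most the Wiener norm of the perturbation.
\<close>

lemma initial_quart_le:
  assumes "m \<in> modes J"
  shows "Re (quart (modes J) (a 0) (a 0) (a 0) (a 0)) \<le> (mass J 0)\<^sup>2 + Sinv * (2 + sqrt Sinv)\<^sup>2 * \<epsilon>\<^sup>2"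
proof -
  let ?d = "sqrt Sinv * \<epsilon> * (2 + sqrt Sinv)"
  have "Re (quart (modes J) (a 0) (a 0) (a 0) (a 0)) \<le> (mass J 0)\<^sup>2 + ?d\<^sup>2"
    unfolding mass_def
  proof (rule quart_le_mass_square)
    fix x
    let ?g = "trig_poly (modes J) (a 0) x" and ?H = "sqrt Sinv * \<epsilon>"
    have "?g = e_mode m x + trig_poly (modes J) h x"
      using assms by (simp add: trig_unit_mode[symmetric, of "modes J"])
        (simp add: trig_poly_def h_def sum.distrib[symmetric] ring_distribs)
    moreover have "cmod (trig_poly (modes J) h x) \<le> ?H"
    proof -
      have "cmod (trig_poly (modes J) h x) \<le> sqrt Sinv * pnorm s (modes J) h"
        using norm_trig_le[of "modes J" h x] sum_cmod_le_pnorm[OF s finite_modes[of J] modes_nonneg, of h] by linarith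
      also have "\<dots> \<le> ?H" using Sinv_ge_1 by (intro mult_left_mono pnorm_h) auto
      finally show ?thesis .
    qed
    ultimately have "\<bar>cmod ?g - 1\<bar> \<le> ?H"
      using norm_triangle_ineq3[of ?g "e_mode m x"] by simp
    moreover from this have "cmod ?g + 1 \<le> 2 + ?H" by linarith
    ultimately have "\<bar>cmod ?g - 1\<bar> * (cmod ?g + 1) \<le> ?H * (2 + ?H)"
      by (intro mult_mono) auto
    moreover have "\<bar>(cmod ?g)\<^sup>2 - 1\<bar> = \<bar>cmod ?g - 1\<bar> * (cmod ?g + 1)"
    proof -
      have "(cmod ?g)\<^sup>2 - 1 = (cmod ?g - 1) * (cmod ?g + 1)" by (simp add: power2_eq_square algebra_simps)
      then show ?thesis by (simp add: abs_mult)
    qed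
    moreover have "?H * (2 + ?H) \<le> ?H * (2 + sqrt Sinv)"
      using \<epsilon> Sinv_ge_1 by (intro mult_left_mono add_left_mono) (auto simp: mult_left_le)
    ultimately show "\<bar>(cmod ?g)\<^sup>2 - 1\<bar> \<le> ?d" by linarith
  qed simp
  moreover have "?d\<^sup>2 = Sinv * (2 + sqrt Sinv)\<^sup>2 * \<epsilon>\<^sup>2"
    using Sinv_ge_1 by (simp add: power_mult_distrib mult_ac)
  ultimately show ?thesis by simp
qed

text \<open>
  The energy is conserved, the quartic form dominates the squared mass at time \<open>t\<close>, and it exceeds the
  squared mass by \<open>O(\<epsilon>\<^sup>2)\<close> at time \<open>0\<close>; what remains of the energy is the spread. Dividing by \<open>\<nu>\<close> turns
  \<open>\<epsilon>\<^sup>2\<close> into \<open>\<delta>\<^sup>2\<close>.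
\<close>

lemma spread_le: "spread m J t \<le> spread_const m * \<delta>\<^sup>2"
proof -
  \<comment> \<open>The total defect of energy and squared mass for the truncation at J.\<close>
  define o1 where "o1 J = (energy m J t - energy m J 0) + (mass J 0 - mass J t) * (mass J 0 + mass J t) / 2" for J
  have o1: "o1 \<longlonglongrightarrow> 0"
  proof -
    obtain C where C: "C \<ge> 0" "\<And>\<tau>. \<bar>\<tau>\<bar> \<le> \<bar>t\<bar> \<Longrightarrow> Hnorm s (a \<tau>) \<le> C"
      using locally_bounded[of "\<bar>t\<bar>"] by auto
    have mass_le: "mass J \<tau> \<le> C\<^sup>2" if "\<bar>\<tau>\<bar> \<le> \<bar>t\<bar>" for J \<tau>
    proof -
      have "mass J \<tau> \<le> (pnorm s (modes J) (a \<tau>))\<^sup>2"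
        unfolding mass_def pnorm_square
        by (intro sum_mono) (use one_le_bracket_square in \<open>simp add: mult_le_cancel_right1\<close>)
      also have "\<dots> \<le> C\<^sup>2"
        using pnorm_le_Hnorm[OF Hspace[of \<tau>] finite_modes[of J]] C(2)[OF that] by (intro power_mono) auto
      finally show ?thesis .
    qed
    have "(\<lambda>J. (mass J 0 - mass J t) * (mass J 0 + mass J t)) \<longlonglongrightarrow> 0"
    proof (rule Lim_null_comparison[OF always_eventually])
      have "(\<lambda>J. \<bar>mass J t - mass J 0\<bar>) \<longlonglongrightarrow> 0" using mass_conserved tendsto_rabs_zero by blast
      then show "(\<lambda>J. \<bar>mass J t - mass J 0\<bar> * (2 * C\<^sup>2)) \<longlonglongrightarrow> 0" by (rule tendsto_mult_left_zero)
      have "mass J \<tau> \<ge> 0" for J \<tau> by (simp add: mass_def sum_nonneg)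
      then show "\<forall>J. norm ((mass J 0 - mass J t) * (mass J 0 + mass J t)) \<le> \<bar>mass J t - mass J 0\<bar> * (2 * C\<^sup>2)"
        using mass_le[of 0] mass_le[of t]
        by (auto simp: abs_mult abs_minus_commute intro!: mult_left_mono abs_leI add_mono) (smt (verit))+
    qed
    from tendsto_add[OF energy_conserved[of m t] tendsto_divide[OF this tendsto_const[of "2"]]]
    show ?thesis unfolding o1_def by simp
  qed
  have main: "\<nu> * spread m J t \<le> \<nu> * spread_const m * \<delta>\<^sup>2 + o1 J'" if J': "J \<le> J'" "m \<in> modes J'" for J'
  proof -
    have "spread m J t \<le> spread m J' t"
      unfolding spread_def using modes_mono[OF J'(1)] by (intro sum_mono2) auto
    then have "\<nu> * spread m J t \<le> \<nu> * spread m J' t" using \<nu>_pos by simp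
    also have "\<dots> \<le> energy m J' t - (mass J' t)\<^sup>2 / 2"
      using mass_square_le_quart[OF finite_modes[of J'], of "a t"] by (simp add: energy_def mass_def)
    also have "\<dots> = energy m J' 0 - (mass J' 0)\<^sup>2 / 2 + o1 J'"
      by (simp add: o1_def power2_eq_square field_simps)
    also have "energy m J' 0 - (mass J' 0)\<^sup>2 / 2
        \<le> \<nu> * ((1 + (of_int m)\<^sup>2) * \<epsilon>\<^sup>2) + Sinv * (2 + sqrt Sinv)\<^sup>2 * \<epsilon>\<^sup>2"
    proof -
      have "\<nu> * spread m J' 0 \<le> \<nu> * ((1 + (of_int m)\<^sup>2) * \<epsilon>\<^sup>2)"
        using \<nu>_pos by (intro mult_left_mono initial_spread_le) auto
      moreover have "0 \<le> Sinv * (2 + sqrt Sinv)\<^sup>2 * \<epsilon>\<^sup>2" using Sinv_ge_1 by simp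
      ultimately show ?thesis using initial_quart_le[OF J'(2)] unfolding energy_def by linarith
    qed
    also have "\<dots> \<le> \<nu> * ((1 + (of_int m)\<^sup>2) * \<delta>\<^sup>2) + Sinv * (2 + sqrt Sinv)\<^sup>2 * (\<nu> * \<delta>\<^sup>2)"
      unfolding \<delta>_square[symmetric] using \<nu>_pos \<epsilon> \<epsilon>_le_\<delta>
      by (intro add_right_mono mult_left_mono power_mono) auto
    also have "\<dots> = \<nu> * spread_const m * \<delta>\<^sup>2" by (simp add: spread_const_def algebra_simps)
    finally show ?thesis by simp
  qed
  have "\<nu> * spread m J t \<le> \<nu> * spread_const m * \<delta>\<^sup>2 + 0"
  proof (rule LIMSEQ_le_const)
    show "(\<lambda>J'. \<nu> * spread_const m * \<delta>\<^sup>2 + o1 J') \<longlonglongrightarrow> \<nu> * spread_const m * \<delta>\<^sup>2 + 0"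
      by (intro tendsto_intros o1)
    show "\<exists>J0. \<forall>J'\<ge>J0. \<nu> * spread m J t \<le> \<nu> * spread_const m * \<delta>\<^sup>2 + o1 J'"
    proof (intro exI[of _ "max J (nat m)"] allI impI main)
      fix J' assume "max J (nat m) \<le> J'"
      then show "J \<le> J'" "m \<in> modes J'" using m by (auto simp: modes_def)
    qed
  qed
  then show ?thesis using \<nu>_pos by (simp add: mult.assoc)
qed

text \<open>
  Mass conservation alone bounds \<open>|a m|\<close> from above. From below, all modes other than \<open>m\<close> carry at most
  the spread, because \<open>(k - m)\<^sup>2 \<ge> 1\<close> there.
\<close>

lemma amplitude:
  shows "cmod (a t m) \<le> 2" and "\<bar>cmod (a t m) - 1\<bar> \<le> (2 + spread_const m) * \<delta>"
proof -
  let ?A = "cmod (a t m)" and ?o = "\<lambda>J. mass J t - mass J 0"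
  have ge: "\<exists>J0. \<forall>J\<ge>J0. m \<in> modes J"
    using m by (intro exI[of _ "nat m"]) (auto simp: modes_def)
  have "?A\<^sup>2 \<le> (1 + \<epsilon>)\<^sup>2 + 0"
  proof (rule LIMSEQ_le_const)
    show "(\<lambda>J. (1 + \<epsilon>)\<^sup>2 + ?o J) \<longlonglongrightarrow> (1 + \<epsilon>)\<^sup>2 + 0" by (intro tendsto_intros mass_conserved)
    have "?A\<^sup>2 \<le> (1 + \<epsilon>)\<^sup>2 + ?o J" if "m \<in> modes J" for J
    proof -
      have "?A\<^sup>2 \<le> mass J t" unfolding mass_def by (rule member_le_sum[OF that]) auto
      then show ?thesis using initial_mass_le[of J] by linarith
    qed
    then show "\<exists>J0. \<forall>J\<ge>J0. ?A\<^sup>2 \<le> (1 + \<epsilon>)\<^sup>2 + ?o J" using ge by blast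
  qed
  then have "?A\<^sup>2 \<le> (1 + \<epsilon>)\<^sup>2" by simp
  then have upper: "?A \<le> 1 + \<epsilon>" by (rule power2_le_imp_le) (use \<epsilon> in simp)
  then show "?A \<le> 2" using \<epsilon> by linarith
  have "(1 - \<epsilon>)\<^sup>2 \<le> ?A\<^sup>2 + spread_const m * \<delta>\<^sup>2 - 0"
  proof (rule LIMSEQ_le_const)
    show "(\<lambda>J. ?A\<^sup>2 + spread_const m * \<delta>\<^sup>2 - ?o J) \<longlonglongrightarrow> ?A\<^sup>2 + spread_const m * \<delta>\<^sup>2 - 0"
      by (intro tendsto_intros mass_conserved)
    have "(1 - \<epsilon>)\<^sup>2 \<le> ?A\<^sup>2 + spread_const m * \<delta>\<^sup>2 - ?o J" if mJ: "m \<in> modes J" for J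
    proof -
      have "1 * cmod (h m) \<le> bracket s m * cmod (h m)"
        using one_le_bracket_square[of m] by (intro mult_right_mono) (auto simp: power2_nonneg_ge_1_iff)
      also have "\<dots> \<le> \<epsilon>" using coefficient_le_Hnorm[OF h_Hspace, of m] Hnorm_h by simp
      finally have "1 - \<epsilon> \<le> cmod (a 0 m)"
        using norm_triangle_ineq2[of 1 "- h m"] by (simp add: h_def unit_mode_def norm_minus_commute)
      then have "(1 - \<epsilon>)\<^sup>2 \<le> (cmod (a 0 m))\<^sup>2" using \<epsilon> by (intro power_mono) auto
      also have "\<dots> \<le> mass J 0" unfolding mass_def by (rule member_le_sum[OF mJ]) auto
      finally have "(1 - \<epsilon>)\<^sup>2 \<le> mass J 0" .
      moreover have "mass J t \<le> ?A\<^sup>2 + spread m J t"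
      proof -
        have "mass J t = ?A\<^sup>2 + (\<Sum>k\<in>modes J - {m}. (cmod (a t k))\<^sup>2)"
          unfolding mass_def using mJ by (intro sum.remove) auto
        also have "(\<Sum>k\<in>modes J - {m}. (cmod (a t k))\<^sup>2) \<le> (\<Sum>k\<in>modes J - {m}. (of_int (k - m))\<^sup>2 * (cmod (a t k))\<^sup>2)"
        proof (rule sum_mono)
          fix k assume "k \<in> modes J - {m}"
          then have "1 \<le> (real_of_int (k - m))\<^sup>2" by (intro one_le_shift_square) auto
          then show "(cmod (a t k))\<^sup>2 \<le> (of_int (k - m))\<^sup>2 * (cmod (a t k))\<^sup>2"
            by (simp add: mult_le_cancel_right1)
        qed
        also have "\<dots> \<le> spread m J t" unfolding spread_def by (intro sum_mono2) auto
        finally show ?thesis by simp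
      qed
      ultimately show ?thesis using spread_le[of J t] by linarith
    qed
    then show "\<exists>J0. \<forall>J\<ge>J0. (1 - \<epsilon>)\<^sup>2 \<le> ?A\<^sup>2 + spread_const m * \<delta>\<^sup>2 - ?o J" using ge by blast
  qed
  then have lower: "1 - 2 * \<epsilon> \<le> ?A\<^sup>2 + spread_const m * \<delta>\<^sup>2"
    by (simp add: power2_eq_square algebra_simps) (smt (verit) zero_le_square)
  have dd: "\<delta>\<^sup>2 \<le> \<delta>" using \<delta>_pos \<delta>_le_1 by (simp add: power2_eq_square mult_left_le)
  have cd: "spread_const m * \<delta>\<^sup>2 \<le> spread_const m * \<delta>"
    using dd spread_const_ge_1[of m] by (intro mult_left_mono) auto
  have c0: "0 \<le> spread_const m * \<delta>" using \<delta>_pos spread_const_ge_1[of m] by simp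
  show "\<bar>?A - 1\<bar> \<le> (2 + spread_const m) * \<delta>"
  proof (cases "?A \<ge> 1")
    case True
    then show ?thesis using upper \<epsilon>_le_\<delta> \<delta>_pos c0 by (simp add: ring_distribs)
  next
    case False
    then have "?A\<^sup>2 \<le> ?A" by (simp add: power2_eq_square mult_left_le)
    then show ?thesis using lower cd \<epsilon>_le_\<delta> False by (simp add: ring_distribs)
  qed
qed

abbreviation W :: "real \<Rightarrow> real" where "W t \<equiv> Hnorm s (without {m} (a t))"

lemma W_0_le: "W 0 \<le> \<delta>"
proof -
  have "W 0 \<le> Hnorm s h"
    by (rule Hspace_mono(2)[OF h_Hspace]) (auto simp: without_def initial_away)
  then show ?thesis using Hnorm_h \<epsilon>_le_\<delta> by simp
qed

text \<open>
  Modes up to \<open>2m\<close> are finitely many and controlled by the spread at all times. The high modes start at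
  size \<open>\<delta>\<close>, and over a time \<open>T\<close> with \<open>growth_const * T \<le> 1/\<delta>\<close> their energy grows by at most \<open>\<delta>\<^sup>2\<close>.
\<close>

lemma W_improve:
  assumes t: "\<bar>t\<bar> \<le> T" and T: "growth_const s m * T \<le> 1 / \<delta>"
    and W: "\<And>\<tau>. \<bar>\<tau>\<bar> \<le> \<bar>t\<bar> \<Longrightarrow> \<tau> * t \<ge> 0 \<Longrightarrow> W \<tau> \<le> bootstrap_const s m * \<delta>"
  shows "W t < bootstrap_const s m * \<delta>"
proof -
  define \<kappa> where "\<kappa> = bootstrap_const s m"
  have \<kappa>: "\<kappa> > 1" unfolding \<kappa>_def by (rule bootstrap_const_gt_1)
  define X where "X F \<tau> = (\<Sum>k\<in>F. (bracket s k)\<^sup>2 * (cmod (a \<tau> k))\<^sup>2)" for F \<tau>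
  have high: "X F t \<le> 2 * \<delta>\<^sup>2" if F: "finite F" "F \<subseteq> {2 * m<..}" for F
  proof -
    have F0: "F \<subseteq> {0..}" using F m by force
    have "\<bar>X F t - X F 0\<bar> \<le> growth_const s m * \<delta> ^ 3 * \<bar>t - 0\<bar>"
    proof -
      have "norm (X F t - X F 0) \<le> growth_const s m * \<delta> ^ 3 * norm (t - 0)"
      proof (rule field_differentiable_bound[where S = "closed_segment 0 t"])
        fix \<tau> assume "\<tau> \<in> closed_segment 0 t"
        then have \<tau>: "\<bar>\<tau>\<bar> \<le> \<bar>t\<bar>" "\<tau> * t \<ge> 0"
          by (auto simp: closed_segment_eq_real_ivl zero_le_mult_iff split: if_splits)
        show "(X F has_real_derivative 2 * (\<Sum>k\<in>F. (bracket s k)\<^sup>2 * Im (cnj (a \<tau> k) * N \<tau> k))) (at \<tau> within closed_segment 0 t)"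
          unfolding X_def by (rule has_field_derivative_at_within[OF high_mode_derivative[OF F0]])
        have "\<bar>\<Sum>k\<in>F. (bracket s k)\<^sup>2 * Im (cnj (a \<tau> k) * N \<tau> k)\<bar>
            \<le> tri_const s * (3 * (bracket s m * cmod (a \<tau> m)) * W \<tau> ^ 3 + W \<tau> ^ 4)"
          by (rule high_mode_pairing_le[OF m F])
        also have "\<dots> \<le> tri_const s * (3 * (bracket s m * 2) * (\<kappa> * \<delta>) ^ 3 + (\<kappa> * \<delta>) ^ 4)"
          using amplitude(1)[of \<tau>] W[OF \<tau>] less_imp_le[OF tri_const_pos[of s]] unfolding \<kappa>_def
          by (intro mult_left_mono add_mono mult_mono power_mono) auto
        also have "\<dots> = tri_const s * (6 * bracket s m * \<kappa> ^ 3 * \<delta> ^ 3 + \<kappa> ^ 4 * (\<delta> ^ 3 * \<delta>))"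
          by (simp add: power_mult_distrib eval_nat_numeral algebra_simps)
        also have "\<dots> \<le> tri_const s * (6 * bracket s m * \<kappa> ^ 3 * \<delta> ^ 3 + \<kappa> ^ 4 * (\<delta> ^ 3 * 1))"
          using \<delta>_pos \<delta>_le_1 \<kappa> less_imp_le[OF tri_const_pos[of s]]
          by (intro mult_left_mono add_left_mono) auto
        finally show "norm (2 * (\<Sum>k\<in>F. (bracket s k)\<^sup>2 * Im (cnj (a \<tau> k) * N \<tau> k))) \<le> growth_const s m * \<delta> ^ 3"
          by (simp add: growth_const_def \<kappa>_def abs_mult algebra_simps)
      qed auto
      then show ?thesis by simp
    qed
    also have "\<dots> \<le> growth_const s m * \<delta> ^ 3 * T"
      using t \<delta>_pos growth_const_pos[of s m] by (intro mult_left_mono) auto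
    also have "\<dots> = (growth_const s m * T) * \<delta> ^ 3" by simp
    also have "\<dots> \<le> (1 / \<delta>) * \<delta> ^ 3"
      using T \<delta>_pos by (intro mult_right_mono) auto
    also have "\<dots> = \<delta>\<^sup>2" using \<delta>_pos by (simp add: power3_eq_cube power2_eq_square)
    finally have "X F t \<le> X F 0 + \<delta>\<^sup>2" by linarith
    moreover have "X F 0 \<le> \<delta>\<^sup>2"
    proof -
      have "X F 0 = (pnorm s F h)\<^sup>2"
        unfolding X_def pnorm_square using F m by (intro sum.cong) (auto simp: initial_away)
      also have "\<dots> \<le> \<delta>\<^sup>2" using pnorm_h[OF F(1)] \<epsilon>_le_\<delta> by (intro power_mono) auto
      finally show ?thesis .
    qed
    ultimately show ?thesis by simp
  qed
  have low: "X F t \<le> (1 + 4 * (of_int m)\<^sup>2) powr s * spread_const m * \<delta>\<^sup>2"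
    if F: "finite F" "F \<subseteq> {0..2 * m} - {m}" for F
  proof -
    have "X F t \<le> (\<Sum>k\<in>F. (1 + 4 * (of_int m)\<^sup>2) powr s * ((of_int (k - m))\<^sup>2 * (cmod (a t k))\<^sup>2))"
      unfolding X_def
    proof (rule sum_mono)
      fix k assume "k \<in> F"
      then have k: "0 \<le> k" "k \<le> 2 * m" "k \<noteq> m" using F by auto
      then have 1: "1 \<le> (real_of_int (k - m))\<^sup>2" by (intro one_le_shift_square)
      have "real_of_int k \<le> 2 * of_int m" using k by linarith
      then have "(real_of_int k)\<^sup>2 \<le> (2 * of_int m)\<^sup>2" using k by (intro power_mono) auto
      then have "(bracket s k)\<^sup>2 \<le> (1 + 4 * (of_int m)\<^sup>2) powr s"
        unfolding bracket_square using s by (intro powr_mono2) (auto simp: power_mult_distrib)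
      then have "(bracket s k)\<^sup>2 * 1 \<le> (1 + 4 * (of_int m)\<^sup>2) powr s * (real_of_int (k - m))\<^sup>2"
        using 1 by (intro mult_mono) auto
      from mult_right_mono[OF this zero_le_power2[of "cmod (a t k)"]]
      show "(bracket s k)\<^sup>2 * (cmod (a t k))\<^sup>2
          \<le> (1 + 4 * (of_int m)\<^sup>2) powr s * ((of_int (k - m))\<^sup>2 * (cmod (a t k))\<^sup>2)"
        by (simp only: mult_1_right mult.assoc)
    qed
    also have "\<dots> = (1 + 4 * (of_int m)\<^sup>2) powr s * (\<Sum>k\<in>F. (of_int (k - m))\<^sup>2 * (cmod (a t k))\<^sup>2)"
      by (simp add: sum_distrib_left)
    also have "(\<Sum>k\<in>F. (of_int (k - m))\<^sup>2 * (cmod (a t k))\<^sup>2) \<le> spread m (nat (2 * m)) t"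
      unfolding spread_def using F m by (intro sum_mono2) (auto simp: modes_def subset_iff)
    also have "\<dots> \<le> spread_const m * \<delta>\<^sup>2" by (rule spread_le)
    finally show ?thesis by (simp add: mult_left_mono mult.assoc)
  qed
  have "W t \<le> sqrt ((\<kappa>\<^sup>2 - 1) * \<delta>\<^sup>2)"
  proof (rule Hnorm_leI(2))
    fix F :: "int set" assume F: "finite F"
    have nonneg: "0 \<le> k" if "a t k \<noteq> 0" for k using supp[of k t] that by force
    have "(pnorm s F (without {m} (a t)))\<^sup>2 = X ((F \<inter> ({0..2 * m} - {m})) \<union> (F \<inter> {2 * m<..})) t"
      unfolding pnorm_square X_def using F m
      by (intro sum.mono_neutral_cong_right) (auto simp: without_def not_le intro: nonneg)
    also have "\<dots> = X (F \<inter> ({0..2 * m} - {m})) t + X (F \<inter> {2 * m<..}) t"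
      unfolding X_def using F by (intro sum.union_disjoint) auto
    also have "\<dots> \<le> (1 + 4 * (of_int m)\<^sup>2) powr s * spread_const m * \<delta>\<^sup>2 + 2 * \<delta>\<^sup>2"
      using F by (intro add_mono low high) auto
    also have "\<dots> = (\<kappa>\<^sup>2 - 1) * \<delta>\<^sup>2"
      unfolding \<kappa>_def bootstrap_const_square by (simp add: algebra_simps)
    finally show "pnorm s F (without {m} (a t)) \<le> sqrt ((\<kappa>\<^sup>2 - 1) * \<delta>\<^sup>2)"
      by (rule real_le_rsqrt)
  qed
  also have "\<dots> < sqrt (\<kappa>\<^sup>2 * \<delta>\<^sup>2)" using \<delta>_pos by (intro real_sqrt_less_mono) simp
  also have "\<dots> = \<kappa> * \<delta>" using \<kappa> \<delta>_pos by (simp add: real_sqrt_mult)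
  finally show ?thesis by (simp add: \<kappa>_def)
qed

text \<open>
  The optimal phase, up to constants, is that of the coefficient \<open>a m\<close>: it leaves only the error in the
  modulus of \<open>a m\<close> besides \<open>w\<close>.
\<close>

lemma orbital_stability:
  assumes t: "growth_const s m * \<bar>t\<bar> \<le> 1 / \<delta>"
  shows "\<exists>\<theta>. Hnorm s (\<lambda>k. a t k - exp (\<i> * of_real \<theta>) * unit_mode m k)
           \<le> (bootstrap_const s m + bracket s m * (2 + spread_const m)) * \<delta>"
proof -
  have W_lt: "W t < bootstrap_const s m * \<delta>"
  proof (rule continuous_bootstrap[where W = W and T = "\<bar>t\<bar>"])
    show "isCont W \<tau>" for \<tau> by (rule isCont_Hnorm_without)
    have "1 * \<delta> < bootstrap_const s m * \<delta>"
      using bootstrap_const_gt_1[of s m] \<delta>_pos by (intro mult_strict_right_mono) auto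
    then show "W 0 < bootstrap_const s m * \<delta>" using W_0_le by linarith
  qed (use W_improve[OF _ t] in auto)
  obtain \<theta> where \<theta>: "a t m = of_real (cmod (a t m)) * exp (\<i> * of_real \<theta>)"
    using rcis_cmod_Arg[of "a t m", symmetric] unfolding rcis_def cis_conv_exp by blast
  let ?c = "a t m - exp (\<i> * of_real \<theta>)"
  let ?e = "\<lambda>k. if k = m then ?c else 0"
  have e: "?e \<in> Hspace s" "Hnorm s ?e \<le> bracket s m * cmod ?c"
    using Hnorm_leI[of s ?e "bracket s m * cmod ?c"] pnorm_single[of _ s m ?c] by auto
  have "cmod ?c = \<bar>cmod (a t m) - 1\<bar>"
  proof -
    have "?c = of_real (cmod (a t m) - 1) * exp (\<i> * of_real \<theta>)"
      using \<theta> by (simp add: ring_distribs)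
    then show ?thesis by (simp only: norm_mult norm_of_real norm_exp_i_times) simp
  qed
  then have "Hnorm s ?e \<le> bracket s m * \<bar>cmod (a t m) - 1\<bar>" using e(2) by (simp only:)
  also have "\<dots> \<le> bracket s m * ((2 + spread_const m) * \<delta>)"
    by (rule mult_left_mono[OF amplitude(2) bracket_nonneg])
  finally have e_le: "Hnorm s ?e \<le> bracket s m * ((2 + spread_const m) * \<delta>)" .
  have eq: "(\<lambda>k. a t k - exp (\<i> * of_real \<theta>) * unit_mode m k) = (\<lambda>k. without {m} (a t) k + ?e k)"
    by (auto simp: without_def unit_mode_def)
  have "Hnorm s (\<lambda>k. a t k - exp (\<i> * of_real \<theta>) * unit_mode m k)
      \<le> (bootstrap_const s m + bracket s m * (2 + spread_const m)) * \<delta>"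
    unfolding eq using W_lt e_le Hspace_add(2)[OF without_Hspace(1)[OF Hspace[of t]] e(1), of "{m}"] by (simp add: ring_distribs)
  then show ?thesis by blast
qed

end

section \<open>From solutions to coefficients\<close>

lemma has_vector_derivative_quotient:
  fixes f :: "real \<Rightarrow> complex"
  assumes "((\<lambda>h. (f (t + h) - f t) / of_real h - v) \<longlongrightarrow> 0) (at 0)"
  shows "(f has_vector_derivative v) (at t)"
  unfolding has_vector_derivative_def has_derivative_at
proof
  show "bounded_linear (\<lambda>h. h *\<^sub>R v)" by (rule bounded_linear_scaleR_left)
  have eq: "cmod ((f (t + h) - f t) / of_real h - v) = norm (f (t + h) - f t - h *\<^sub>R v) / norm h" if "h \<noteq> 0" for h
  proof -
    have "(f (t + h) - f t) / of_real h - v = (f (t + h) - f t - h *\<^sub>R v) / of_real h"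
      using that by (simp add: scaleR_conv_of_real diff_divide_distrib)
    then show ?thesis by (simp add: norm_divide)
  qed
  have "((\<lambda>h. cmod ((f (t + h) - f t) / of_real h - v)) \<longlongrightarrow> 0) (at 0)"
    using assms by (rule tendsto_norm_zero)
  then show "((\<lambda>h. norm (f (t + h) - f t - h *\<^sub>R v) / norm h) \<longlongrightarrow> 0) (at 0)"
    by (rule Lim_transform_eventually) (use eq in \<open>auto simp: eventually_at_filter\<close>)
qed

text \<open>
  The norm of \<open>H\<^sup>r\<close> controls each coefficient, for negative \<open>r\<close> too, so the difference quotients
  converge coefficientwise.
\<close>

lemma has_Hspace_derivative_coefficient:
  assumes "has_Hspace_derivative r a v t"
  shows "((\<lambda>\<tau>. a \<tau> k) has_vector_derivative v k) (at t)"
proof (rule has_vector_derivative_quotient)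
  have v: "v \<in> Hspace r" and a: "\<And>\<tau>. a \<tau> \<in> Hspace r"
    and lim: "((\<lambda>h. Hnorm r (\<lambda>k. (a (t + h) k - a t k) / of_real h - v k)) \<longlongrightarrow> 0) (at 0)"
    using assms by (auto simp: has_Hspace_derivative_def)
  have "(\<lambda>k. (a (t + h) k - a t k) / of_real h - v k) \<in> Hspace r" for h
    using Hspace_diff[OF Hspace_scale[OF Hspace_diff[OF a[of "t + h"] a[of t]], of "1 / of_real h"] v] by simp
  from tendsto_coefficient[OF lim this]
  show "((\<lambda>h. (a (t + h) k - a t k) / of_real h - v k) \<longlongrightarrow> 0) (at 0)" .
qed

lemma solution_coefficient_flow:
  assumes s: "s \<ge> 1" and \<nu>: "0 < \<nu>" "\<nu> \<le> 1" and u: "szego_schroedinger_solution s \<nu> u"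
  shows "coefficient_flow s \<nu> (\<lambda>t. fourier (u t)) (\<lambda>t. fourier (\<lambda>x. of_real ((cmod (u t x))\<^sup>2) * u t x))"
proof
  have mem: "\<And>t. u t \<in> sobolev_plus s"
    and cont: "\<And>t. ((\<lambda>\<tau>. sobolev_norm s (\<lambda>x. u \<tau> x - u t x)) \<longlongrightarrow> 0) (at t)"
    using u by (auto simp: szego_schroedinger_solution_def continuous_sobolev_plus_def)
  note props = sobolev_plusD[OF mem]
  show "fourier (u t) k = 0" if "k < 0" for t k by (rule props(4)[OF that])
  show "fourier (u t) \<in> Hspace s" for t by (rule props(3))
  have diff: "fourier (\<lambda>x. u \<tau> x - u t x) = (\<lambda>k. fourier (u \<tau>) k - fourier (u t) k)" for \<tau> t
    by (intro ext fourier_diff props)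
  show "((\<lambda>\<tau>. Hnorm s (\<lambda>k. fourier (u \<tau>) k - fourier (u t) k)) \<longlongrightarrow> 0) (at t)" for t
    using cont[of t] unfolding sobolev_norm_def diff .
  show "(\<lambda>J. tri (modes J) (fourier (u t)) (fourier (u t)) (fourier (u t)) k)
      \<longlonglongrightarrow> fourier (\<lambda>x. of_real ((cmod (u t x))\<^sup>2) * u t x) k" for t k
    by (rule fourier_cubic_sobolev[OF s mem])
  show "((\<lambda>\<tau>. fourier (u \<tau>) k) has_vector_derivative
      - \<i> * (of_real (\<nu> * (of_int k)\<^sup>2) * fourier (u t) k + fourier (\<lambda>x. of_real ((cmod (u t x))\<^sup>2) * u t x) k)) (at t)"
    if "0 \<le> k" for t k
  proof -
    obtain v where v: "has_Hspace_derivative (s - 2) (\<lambda>\<tau>. fourier (u \<tau>)) v t"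
      and eq: "\<And>k. \<i> * v k + of_real \<nu> * Dx (Dx (fourier (u t))) k
               = szego (fourier (\<lambda>x. of_real ((cmod (u t x))\<^sup>2) * u t x)) k"
      using u unfolding szego_schroedinger_solution_def by blast
    let ?N = "fourier (\<lambda>x. of_real ((cmod (u t x))\<^sup>2) * u t x) k"
    have "Dx (Dx (fourier (u t))) k = (\<i> * \<i>) * ((of_int k)\<^sup>2 * fourier (u t) k)"
      by (simp only: Dx_def power2_eq_square mult_ac)
    then have "Dx (Dx (fourier (u t))) k = - ((of_int k)\<^sup>2 * fourier (u t) k)" by simp
    then have iv: "\<i> * v k = of_real (\<nu> * (of_int k)\<^sup>2) * fourier (u t) k + ?N"
      using eq[of k] that by (simp add: szego_def algebra_simps)
    have "v k = - \<i> * (\<i> * v k)" by simp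
    then have "v k = - \<i> * (of_real (\<nu> * (of_int k)\<^sup>2) * fourier (u t) k + ?N)" unfolding iv .
    then show ?thesis using has_Hspace_derivative_coefficient[OF v, of k] by (simp only:)
  qed
qed (use s \<nu> in auto)

lemma fourier_diff_mode:
  assumes "f \<in> sobolev_plus s"
  shows "fourier (\<lambda>x. f x - c * e_mode m x) = (\<lambda>k. fourier f k - c * unit_mode m k)"
proof
  fix k
  have "integrable circ (\<lambda>x. c * e_mode m x)"
    by (intro integrable_mult_right integrable_circ_bounded[where C = 1]) auto
  from fourier_diff[OF sobolev_plusD(1)[OF assms] this]
  show "fourier (\<lambda>x. f x - c * e_mode m x) k = fourier f k - c * unit_mode m k"
    by (simp add: fourier_scale fourier_e_mode unit_mode_def)
qed

theorem proposition1p7: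
  "\<forall>(s::real) (m::nat). s \<ge> 1 \<longrightarrow>
     (\<exists>(b::real) (L::real). 0 < b \<and> b < 1 \<and> L > 0 \<and>
       (\<forall>(\<alpha>::real) (\<epsilon>::real) (u :: real \<Rightarrow> real \<Rightarrow> complex).
          0 \<le> \<alpha> \<longrightarrow> \<alpha> < 2 \<longrightarrow> 0 < \<epsilon> \<longrightarrow> \<epsilon> < 1 \<longrightarrow>
          szego_schroedinger_solution s (\<epsilon> powr \<alpha>) u \<longrightarrow>
          sobolev_norm s (\<lambda>x. u 0 x - e_mode (int m) x) = \<epsilon> \<longrightarrow>
          (SUP t \<in> {t::real. \<bar>t\<bar> \<le> b * \<epsilon> powr (- (1 - \<alpha> / 2))}.
             INF \<theta>::real. ereal (sobolev_norm s (\<lambda>x. u t x - exp (\<i> * of_real \<theta>) * e_mode (int m) x)))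
          \<le> ereal (L * \<epsilon> powr (1 - \<alpha> / 2))))"
proof (intro allI impI)
  fix s :: real and m :: nat assume s: "s \<ge> 1"
  define M where "M = int m"
  define b where "b = min (1 / 2) (1 / growth_const s M)"
  define L where "L = bootstrap_const s M + bracket s M * (2 + spread_const M)"
  have b: "0 < b" "b < 1" "growth_const s M * b \<le> 1"
  proof -
    show "0 < b" using growth_const_pos[of s M] by (simp add: b_def)
    show "b < 1" by (simp add: b_def)
    have "growth_const s M * b \<le> growth_const s M * (1 / growth_const s M)"
      using growth_const_pos[of s M] by (intro mult_left_mono) (auto simp: b_def)
    then show "growth_const s M * b \<le> 1" using growth_const_pos[of s M] by simp
  qed
  have L: "L > 0"
    unfolding L_def using bootstrap_const_gt_1[of s M] spread_const_ge_1[of M]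
    by (intro add_pos_pos mult_pos_pos bracket_pos) auto
  show "\<exists>(b::real) (L::real). 0 < b \<and> b < 1 \<and> L > 0 \<and>
       (\<forall>(\<alpha>::real) (\<epsilon>::real) (u :: real \<Rightarrow> real \<Rightarrow> complex).
          0 \<le> \<alpha> \<longrightarrow> \<alpha> < 2 \<longrightarrow> 0 < \<epsilon> \<longrightarrow> \<epsilon> < 1 \<longrightarrow>
          szego_schroedinger_solution s (\<epsilon> powr \<alpha>) u \<longrightarrow>
          sobolev_norm s (\<lambda>x. u 0 x - e_mode (int m) x) = \<epsilon> \<longrightarrow>
          (SUP t \<in> {t::real. \<bar>t\<bar> \<le> b * \<epsilon> powr (- (1 - \<alpha> / 2))}.
             INF \<theta>::real. ereal (sobolev_norm s (\<lambda>x. u t x - exp (\<i> * of_real \<theta>) * e_mode (int m) x)))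
          \<le> ereal (L * \<epsilon> powr (1 - \<alpha> / 2)))"
  proof (rule exI[of _ b], rule exI[of _ L], intro conjI b(1,2) L allI impI)
    fix \<alpha> \<epsilon> :: real and u :: "real \<Rightarrow> real \<Rightarrow> complex"
    assume \<alpha>: "0 \<le> \<alpha>" "\<alpha> < 2" and \<epsilon>: "0 < \<epsilon>" "\<epsilon> < 1"
      and u: "szego_schroedinger_solution s (\<epsilon> powr \<alpha>) u"
      and init: "sobolev_norm s (\<lambda>x. u 0 x - e_mode (int m) x) = \<epsilon>"
    define \<delta> where "\<delta> = \<epsilon> powr (1 - \<alpha> / 2)"
    have mem: "u t \<in> sobolev_plus s" for t
      using u by (auto simp: szego_schroedinger_solution_def continuous_sobolev_plus_def)
    have norm: "sobolev_norm s (\<lambda>x. u t x - c * e_mode (int m) x)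
        = Hnorm s (\<lambda>k. fourier (u t) k - c * unit_mode M k)" for t c
      unfolding sobolev_norm_def M_def fourier_diff_mode[OF mem] ..
    have \<nu>: "0 < \<epsilon> powr \<alpha>" "\<epsilon> powr \<alpha> \<le> 1"
      using \<epsilon> \<alpha> by (auto intro: powr_le1)
    interpret flow: coefficient_flow s "\<epsilon> powr \<alpha>" "\<lambda>t. fourier (u t)" "\<lambda>t. fourier (\<lambda>x. of_real ((cmod (u t x))\<^sup>2) * u t x)"
      by (rule solution_coefficient_flow[OF s \<nu> u])
    interpret perturbed_mode s "\<epsilon> powr \<alpha>" "\<lambda>t. fourier (u t)" "\<lambda>t. fourier (\<lambda>x. of_real ((cmod (u t x))\<^sup>2) * u t x)" M \<epsilon> \<delta>
    proof
      show "0 \<le> M" by (simp add: M_def)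
      show "0 < \<epsilon>" "\<epsilon> < 1" by (rule \<epsilon>)+
      show "Hnorm s (\<lambda>k. fourier (u 0) k - unit_mode M k) = \<epsilon>" using init norm[of 0 1] by simp
      show "\<epsilon> \<le> \<delta>"
        using powr_mono'[of "1 - \<alpha> / 2" 1 \<epsilon>] \<epsilon> \<alpha> by (simp add: \<delta>_def)
      show "\<delta> \<le> 1" unfolding \<delta>_def using \<epsilon> \<alpha> by (intro powr_le1) auto
      have "\<epsilon> powr \<alpha> * (\<delta> * \<delta>) = \<epsilon> powr (\<alpha> + ((1 - \<alpha> / 2) + (1 - \<alpha> / 2)))"
        unfolding \<delta>_def by (simp only: powr_add)
      also have "\<alpha> + ((1 - \<alpha> / 2) + (1 - \<alpha> / 2)) = 2" by simp
      also have "\<epsilon> powr 2 = \<epsilon>\<^sup>2" using \<epsilon>(1) by (simp add: powr_numeral)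
      finally show "\<epsilon>\<^sup>2 = \<epsilon> powr \<alpha> * \<delta>\<^sup>2" by (simp only: power2_eq_square)
    qed
    show "(SUP t \<in> {t::real. \<bar>t\<bar> \<le> b * \<epsilon> powr (- (1 - \<alpha> / 2))}.
             INF \<theta>::real. ereal (sobolev_norm s (\<lambda>x. u t x - exp (\<i> * of_real \<theta>) * e_mode (int m) x)))
          \<le> ereal (L * \<epsilon> powr (1 - \<alpha> / 2))"
    proof (rule SUP_least)
      fix t assume "t \<in> {t::real. \<bar>t\<bar> \<le> b * \<epsilon> powr (- (1 - \<alpha> / 2))}"
      then have "\<bar>t\<bar> \<le> b * (1 / \<delta>)"
        unfolding \<delta>_def powr_minus_divide by simp
      then have "growth_const s M * \<bar>t\<bar> \<le> growth_const s M * (b * (1 / \<delta>))"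
        using growth_const_pos[of s M] by (intro mult_left_mono) auto
      also have "\<dots> = (growth_const s M * b) * (1 / \<delta>)" by (simp only: mult.assoc)
      also have "\<dots> \<le> 1 * (1 / \<delta>)" using b(3) \<delta>_pos by (intro mult_right_mono) auto
      finally have "growth_const s M * \<bar>t\<bar> \<le> 1 / \<delta>" by simp
      from orbital_stability[OF this] obtain \<theta>
        where "Hnorm s (\<lambda>k. fourier (u t) k - exp (\<i> * of_real \<theta>) * unit_mode M k) \<le> L * \<delta>"
        unfolding L_def by blast
      then have "ereal (sobolev_norm s (\<lambda>x. u t x - exp (\<i> * of_real \<theta>) * e_mode (int m) x))
          \<le> ereal (L * \<epsilon> powr (1 - \<alpha> / 2))"
        unfolding norm by (simp add: \<delta>_def)
      then show "(INF \<theta>::real. ereal (sobolev_norm s (\<lambda>x. u t x - exp (\<i> * of_real \<theta>) * e_mode (int m) x)))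
          \<le> ereal (L * \<epsilon> powr (1 - \<alpha> / 2))"
        by (rule INF_lower2[OF UNIV_I])
    qed
  qed
qed

end
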